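(* A convex body $K\subset\mathbb{C}^n$ is a (complex) ellipsoid if and only if for every complex affine line $L\subset\mathbb{C}^n$, the intersection $L\cap K$ is either empty, a single point, or a closed disk in $L$.
   Context: A convex body is a compact convex subset of $\mathbb{C}^n$ with nonempty interior. A (complex) ellipsoid in $\mathbb{C}^n$ is the image of the closed Euclidean unit ball of $\mathbb{C}^n$ under an invertible complex affine map $z\mapsto Az+b$ ($A\in GL_n(\mathbb{C})$, $b\in\mathbb{C}^n$). A complex affine line is a set $\{a+zv:z\in\mathbb{C}\}$ with $v\neq 0$; a disk in it is a closed Euclidean round disk of positive radius in that line. *)

theory Defs
  imports "HOL-Analysis.Analysis"
begin

definition convex_body :: "(complex ^ 'n) set \<Rightarrow> bool" where
  "convex_body K \<longleftrightarrow> compact K \<and> convex K \<and> interior K \<noteq> {}"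

definition complex_ellipsoid :: "(complex ^ 'n) set \<Rightarrow> bool" where
  "complex_ellipsoid E \<longleftrightarrow>
     (\<exists>(A :: complex ^ 'n ^ 'n) b. invertible A \<and> E = (\<lambda>z. A *v z + b) ` cball 0 1)"

definition complex_line :: "complex ^ 'n \<Rightarrow> complex ^ 'n \<Rightarrow> (complex ^ 'n) set" where
  "complex_line a v = {a + z *s v | z. True}"

definition is_complex_line :: "(complex ^ 'n) set \<Rightarrow> bool" where
  "is_complex_line L \<longleftrightarrow> (\<exists>a v. v \<noteq> 0 \<and> L = complex_line a v)"

definition is_disk_in :: "(complex ^ 'n) set \<Rightarrow> (complex ^ 'n) set \<Rightarrow> bool" where
  "is_disk_in D L \<longleftrightarrow> (\<exists>p r. p \<in> L \<and> r > 0 \<and> D = L \<inter> cball p r)"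

end

theory Submission
  imports Defs
begin

text \<open>For the converse, translate \<open>K\<close> so that its point farthest from the original origin is \<open>0\<close>,
  and let \<open>\<phi> = 0\<close> be the complex tangent hyperplane there. Convexity forces every transversal line
  through \<open>0\<close> to meet \<open>K\<close> in a disk tangent to the hyperplane, so membership of \<open>v\<close> in \<open>K\<close> reads
  \<open>\<alpha> v + 2 Re (\<phi> v) \<le> 0\<close> with \<open>\<alpha> (c v) = |c|\<^sup>2 \<alpha> v\<close>. The projective change of coordinates that sends
  the hyperplane to infinity turns \<open>K\<close> into the region above the graph of \<open>\<alpha>\<close> on \<open>\<phi> = -1\<close>, and the
  line sections say that along each complex line in \<open>\<phi> = -1\<close> every set \<open>{\<alpha> \<le> affine}\<close> is a disk.
  Comparing the pencils of circles arising this way shows that \<open>\<alpha>\<close> has the form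
  \<open>A |z|\<^sup>2 + 2 Re (B z) + C\<close> on such a line. Hence \<open>\<alpha>\<close> obeys the parallelogram law, extends to a
  positive definite Hermitian form, and \<open>K\<close> is an ellipsoid.\<close>

section \<open>Functions whose affine sublevel sets are disks\<close>

text \<open>Completing the square. According to the sign of \<open>(cmod B)\<^sup>2 - C\<close> the
  inequality describes the empty set, a point or a disk, so this form spares the trichotomy in all
  later arguments.\<close>

lemma disk_inequality_iff:
  "(cmod z)\<^sup>2 + 2 * Re (B * z) + C \<le> 0 \<longleftrightarrow> (cmod (z + cnj B))\<^sup>2 \<le> (cmod B)\<^sup>2 - C"
  unfolding cmod_power2 by (simp add: power2_eq_square algebra_simps)

lemma disk_set_eq:
  "{z. (cmod z)\<^sup>2 + 2 * Re (B * z) + C \<le> 0} =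
     (if (cmod B)\<^sup>2 - C < 0 then {} else cball (- cnj B) (sqrt ((cmod B)\<^sup>2 - C)))"
proof (cases "(cmod B)\<^sup>2 - C < 0")
  case True
  then have "\<not> (cmod (z + cnj B))\<^sup>2 \<le> (cmod B)\<^sup>2 - C" for z
    using zero_le_power2[of "cmod (z + cnj B)"] by linarith
  with True show ?thesis unfolding disk_inequality_iff by simp
next
  case False
  have "(cmod (z + cnj B))\<^sup>2 \<le> (cmod B)\<^sup>2 - C \<longleftrightarrow> z \<in> cball (- cnj B) (sqrt ((cmod B)\<^sup>2 - C))" for z
  proof -
    have "z \<in> cball (- cnj B) (sqrt ((cmod B)\<^sup>2 - C)) \<longleftrightarrow> cmod (z + cnj B) \<le> sqrt ((cmod B)\<^sup>2 - C)"
      by (simp add: dist_norm norm_minus_commute add.commute)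
    also have "\<dots> \<longleftrightarrow> (cmod (z + cnj B))\<^sup>2 \<le> (cmod B)\<^sup>2 - C"
      using False by (metis abs_norm_cancel real_sqrt_abs real_sqrt_le_iff)
    finally show ?thesis by blast
  qed
  then show ?thesis
    unfolding disk_inequality_iff if_not_P[OF False] by blast
qed

lemma convex_disk_set: "convex {z. (cmod z)\<^sup>2 + 2 * Re (B * z) + C \<le> 0}"
  unfolding disk_set_eq by simp

section \<open>Circles with a common chord\<close>

lemma continuous_le_zero_at_right:
  fixes h :: "real \<Rightarrow> real"
  assumes "continuous_on UNIV h" and "\<And>t. t > 0 \<Longrightarrow> h t \<le> 0"
  shows "h 0 \<le> 0"
proof (rule tendsto_upperbound)
  show "(h \<longlongrightarrow> h 0) (at_right 0)"
    using assms(1) by (simp add: continuous_on_eq_continuous_at isCont_def filterlim_at_split)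
  show "\<forall>\<^sub>F t in at_right 0. h t \<le> 0"
    using assms(2) by (auto simp: eventually_at_right_field intro: exI[of _ 1])
qed simp

text \<open>At both endpoints \<open>sqrt D\<close> and \<open>- sqrt D\<close> the second quadratic
  is at most 0 by hypothesis and at least 0 as a limit from outside the interval, hence 0. These two
  equations determine both coefficients.\<close>

lemma quadratic_sublevel_unique:
  fixes \<beta> C D :: real
  assumes "D > 0" and eq: "\<And>t. t\<^sup>2 \<le> D \<longleftrightarrow> t\<^sup>2 + \<beta> * t + C \<le> 0"
  shows "\<beta> = 0" "C = - D"
proof -
  have sq: "(sqrt D)\<^sup>2 = D" and pos: "sqrt D > 0" using assms by auto
  have ge: "D + \<beta> * (e * sqrt D) + C \<ge> 0" if "e = 1 \<or> e = -1" for e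
  proof -
    define h where "h t = - ((e * (sqrt D + t))\<^sup>2 + \<beta> * (e * (sqrt D + t)) + C)" for t
    have "h 0 \<le> 0"
    proof (rule continuous_le_zero_at_right)
      show "continuous_on UNIV h" unfolding h_def by (intro continuous_intros)
      fix t :: real assume "t > 0"
      then have "(sqrt D)\<^sup>2 < (sqrt D + t)\<^sup>2"
        using pos by (intro power_strict_mono) auto
      then have "\<not> (e * (sqrt D + t))\<^sup>2 \<le> D"
        using that sq by (auto simp: power_mult_distrib)
      then show "h t \<le> 0" using eq[of "e * (sqrt D + t)"] unfolding h_def by linarith
    qed
    then show ?thesis using that sq by (auto simp: h_def power_mult_distrib)
  qed
  have le: "D + \<beta> * (e * sqrt D) + C \<le> 0" if "e = 1 \<or> e = -1" for e
    using eq[of "e * sqrt D"] that sq by (auto simp: power_mult_distrib)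
  have "D + \<beta> * sqrt D + C = 0" "D - \<beta> * sqrt D + C = 0"
    using ge[of 1] le[of 1] ge[of "-1"] le[of "-1"] by auto
  then have "\<beta> * sqrt D = 0" "C = - D" by linarith+
  then show "\<beta> = 0" "C = - D" using pos by auto
qed

text \<open>Restricting both inequalities to the line \<open>Re (b * z) = 0\<close> fixes
  \<open>C\<close> and makes \<open>B * cnj b\<close> real. The second circle thus belongs to the
  pencil spanned by the first circle and the line.\<close>

lemma disks_with_common_chord:
  assumes "D > 0" "b \<noteq> 0"
    and eq: "\<And>z. Re (b * z) = 0 \<Longrightarrow> (cmod z)\<^sup>2 \<le> D \<longleftrightarrow> (cmod z)\<^sup>2 + 2 * Re (B * z) + C \<le> 0"
  shows "C = - D" "\<exists>k. B = complex_of_real k * b"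
proof -
  \<comment> \<open>A unit vector spanning the real line \<open>Re (b * z) = 0\<close>.\<close>
  define e where "e = \<i> * cnj b / cmod b"
  have e: "cmod e = 1" "Re (b * e) = 0"
    using assms(2) by (auto simp: e_def norm_mult norm_divide)
  have *: "t\<^sup>2 \<le> D \<longleftrightarrow> t\<^sup>2 + (2 * Re (B * e)) * t + C \<le> 0" for t
  proof -
    have "Re (b * (of_real t * e)) = 0" using e(2) by (simp add: mult.left_commute[of b])
    from eq[OF this] show ?thesis
      using e by (simp add: norm_mult power_mult_distrib algebra_simps)
  qed
  show "C = - D" using quadratic_sublevel_unique(2)[OF assms(1) *] .
  have "Re (B * e) = 0" using quadratic_sublevel_unique(1)[OF assms(1) *] by simp
  then have im: "Im (B * cnj b) = 0"
    using assms(2) by (simp add: e_def field_simps)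
  have "B * (b * cnj b) = of_real (Re (B * cnj b)) * b"
    using im by (simp add: complex_eq_iff algebra_simps)
  then have "B * of_real ((cmod b)\<^sup>2) = of_real (Re (B * cnj b)) * b"
    by (simp only: complex_norm_square)
  then have "B = of_real (Re (B * cnj b)) * b / of_real ((cmod b)\<^sup>2)"
    using assms(2) by (intro eq_divide_imp) auto
  then have "B = of_real (Re (B * cnj b) / (cmod b)\<^sup>2) * b"
    by (simp only: of_real_divide times_divide_eq_left)
  then show "\<exists>k. B = complex_of_real k * b" by blast
qed

section \<open>From disk sublevel sets to paraboloids\<close>

text \<open>Take an affine function that agrees with \<open>g\<close> at \<open>x\<close> and
  \<open>y\<close>. Its sublevel set is a disk, hence convex, and contains the segment, on which
  \<open>g\<close> therefore lies below the chord.\<close>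

lemma convex_if_affine_sublevels_disks:
  fixes g :: "complex \<Rightarrow> real"
  assumes "\<And>a b. \<exists>B C. \<forall>z. g z \<le> a + 2 * Re (b * z) \<longleftrightarrow> (cmod z)\<^sup>2 + 2 * Re (B * z) + C \<le> 0"
  shows "convex_on UNIV g"
proof (intro convex_onI)
  fix t :: real and x y :: complex assume t: "0 < t" "t < 1"
  show "g ((1 - t) *\<^sub>R x + t *\<^sub>R y) \<le> (1 - t) * g x + t * g y"
  proof (cases "x = y")
    case True then show ?thesis by (simp add: scaleR_left_diff_distrib algebra_simps)
  next
    case False
    define b where "b = of_real ((g x - g y) / (2 * (cmod (x - y))\<^sup>2)) * cnj (x - y)"
    define a where "a = g x - 2 * Re (b * x)"
    have "b * (x - y) = of_real ((g x - g y) / (2 * (cmod (x - y))\<^sup>2)) * of_real ((cmod (x - y))\<^sup>2)"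
      by (simp only: b_def complex_norm_square mult.assoc mult.commute[of "cnj (x-y)"])
    also have "\<dots> = of_real ((g x - g y) / 2)" using False by (simp add: field_simps)
    finally have "Re (b * (x - y)) = (g x - g y) / 2" by (metis Re_complex_of_real)
    then have b: "2 * Re (b * (x - y)) = g x - g y" by simp
    then have gy: "g y = a + 2 * Re (b * y)" and gx: "g x = a + 2 * Re (b * x)"
      unfolding a_def by (simp_all add: algebra_simps)
    obtain B C where BC: "\<And>z. g z \<le> a + 2 * Re (b * z) \<longleftrightarrow> (cmod z)\<^sup>2 + 2 * Re (B * z) + C \<le> 0"
      using assms[of a b] by blast
    have "x \<in> {z. (cmod z)\<^sup>2 + 2 * Re (B * z) + C \<le> 0}" "y \<in> {z. (cmod z)\<^sup>2 + 2 * Re (B * z) + C \<le> 0}"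
      using BC[of x] BC[of y] gx gy by auto
    from convexD_alt[OF convex_disk_set this, of t] t
    have "g ((1 - t) *\<^sub>R x + t *\<^sub>R y) \<le> a + 2 * Re (b * ((1 - t) *\<^sub>R x + t *\<^sub>R y))"
      unfolding BC by auto
    also have "\<dots> = (1 - t) * g x + t * g y"
      unfolding gx gy by (simp add: algebra_simps)
    finally show ?thesis .
  qed
qed simp

text \<open>One reference point on the real axis outside the disk fixes \<kappa>. Every point off
  the real axis is compared with it through a suitable \<open>b\<close>, and continuity of the
  convex function \<open>G\<close> covers the real axis.\<close>

lemma affine_sublevels_disks_centred:
  fixes G :: "complex \<Rightarrow> real"
  assumes P: "\<And>a b. \<exists>B C. \<forall>z. G z \<le> a + 2 * Re (b * z) \<longleftrightarrow> (cmod z)\<^sup>2 + 2 * Re (B * z) + C \<le> 0"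
    and D: "D > 0" and G0: "\<And>z. G z \<le> 0 \<longleftrightarrow> (cmod z)\<^sup>2 \<le> D"
  shows "\<exists>\<kappa>>0. \<forall>z. G z = \<kappa> * ((cmod z)\<^sup>2 - D)"
proof -
  have conv: "convex_on UNIV G" by (rule convex_if_affine_sublevels_disks[OF P])
  have cont: "continuous_on UNIV G" by (rule convex_on_continuous[OF open_UNIV conv])
  text \<open>The disks \<open>{G \<le> 0}\<close> and \<open>{G \<le> 2 s Re (b z)}\<close> have a common chord on the line \<open>Re (b z) = 0\<close>, so
    the second boundary circle lies in the pencil spanned by the first circle and that line.
    On this circle \<open>G\<close> and \<open>|z|\<^sup>2 - D\<close> are proportional.\<close>
  have key: "G y = G x / ((cmod x)\<^sup>2 - D) * ((cmod y)\<^sup>2 - D)"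
    if x: "(cmod x)\<^sup>2 > D" and bx: "2 * Re (b * x) = (cmod x)\<^sup>2 - D"
      and bY: "2 * Re (b * y) = (cmod y)\<^sup>2 - D" for x y b
  proof -
    \<comment> \<open>This slope gives equality \<open>G x = 2 * s * Re (b * x)\<close> at the point
      \<open>x\<close> of the circle.\<close>
    define s where "s = G x / ((cmod x)\<^sup>2 - D)"
    have Gx: "G x > 0" using G0[of x] x by simp
    have s: "s > 0" using Gx x by (simp add: s_def)
    have b0: "b \<noteq> 0" using bx x by auto
    obtain B C where BC: "\<And>z. G z \<le> 2 * s * Re (b * z) \<longleftrightarrow> (cmod z)\<^sup>2 + 2 * Re (B * z) + C \<le> 0"
    proof -
      have "2 * Re (of_real s * b * z) = 2 * s * Re (b * z)" for z by (simp add: algebra_simps)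
      then show ?thesis using P[of 0 "of_real s * b"] that by auto
    qed
    have chord: "(cmod z)\<^sup>2 \<le> D \<longleftrightarrow> (cmod z)\<^sup>2 + 2 * Re (B * z) + C \<le> 0" if "Re (b * z) = 0" for z
      using BC[of z] G0[of z] that by simp
    have C: "C = - D" by (rule disks_with_common_chord(1)[OF D b0 chord])
    obtain k' where k': "B = of_real k' * b"
      using disks_with_common_chord(2)[OF D b0 chord] by blast
    define k where "k = - k'"
    have k: "G z \<le> 2 * s * Re (b * z) \<longleftrightarrow> (cmod z)\<^sup>2 - D \<le> k * (2 * Re (b * z))" for z
      unfolding BC C k' k_def by (simp add: algebra_simps)
    have Gxs: "G x = 2 * s * Re (b * x)"
    proof -
      have "2 * s * Re (b * x) = s * ((cmod x)\<^sup>2 - D)" using bx by (metis mult.assoc mult.commute)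
      then show ?thesis using x by (simp add: s_def)
    qed
    then have "(cmod x)\<^sup>2 - D \<le> k * ((cmod x)\<^sup>2 - D)" using k[of x] bx by simp
    then have k1: "k \<ge> 1" using x by simp
    \<comment> \<open>If \<open>k > 1\<close>, then \<open>x\<close> is interior to the second disk,
      so the segment from a point \<open>e\<close> through \<open>x\<close> can be prolonged to some
      \<open>y\<close> in the disk. With \<open>G e \<le> 0 < Re (b * e)\<close>, convexity of
      \<open>G\<close> along it makes the inequality at \<open>x\<close> strict, against the choice
      of \<open>s\<close>.\<close>
    have "k = 1"
    proof (rule ccontr)
      assume "k \<noteq> 1"
      with k1 have k1: "k > 1" by simp
      define e where "e = of_real (sqrt D / cmod b) * cnj b"
      have "cmod e = sqrt D" using b0 D by (simp add: e_def norm_mult norm_divide)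
      then have Ge: "G e \<le> 0" using G0[of e] D by simp
      have "b * e = of_real (sqrt D / cmod b) * of_real ((cmod b)\<^sup>2)"
        by (simp only: e_def complex_norm_square mult.assoc mult.left_commute)
      then have "Re (b * e) = sqrt D / cmod b * (cmod b)\<^sup>2" by (metis Re_complex_of_real of_real_mult)
      then have be: "Re (b * e) > 0" using b0 D by simp
      define h where "h t = - ((cmod (x + of_real t * (x - e)))\<^sup>2 - D - k * (2 * Re (b * (x + of_real t * (x - e)))))" for t :: real
      have "1 * ((cmod x)\<^sup>2 - D) < k * ((cmod x)\<^sup>2 - D)" using k1 x by (intro mult_strict_right_mono) auto
      then have "h 0 > 0" unfolding h_def by (simp add: bx del: times_complex.sel)
      have "\<exists>t>0. h t > 0"
      proof (rule ccontr)
        assume "\<not> ?thesis"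
        moreover have "continuous_on UNIV h" unfolding h_def by (intro continuous_intros)
        ultimately have "h 0 \<le> 0"
          using continuous_le_zero_at_right[of h] by (meson not_less)
        with \<open>h 0 > 0\<close> show False by simp
      qed
      then obtain t where t: "t > 0" "h t > 0" by blast
      define y where "y = x + of_real t * (x - e)"
      have Gy: "G y \<le> 2 * s * Re (b * y)" using t(2) k[of y] by (simp add: h_def y_def)
      define r where "r = 1 / (1 + t)"
      have r: "0 < r" "r < 1" "r * (1 + t) = 1" using t by (auto simp: r_def)
      have xr: "x = (1 - r) *\<^sub>R e + r *\<^sub>R y"
      proof -
        have "(1 - r) *\<^sub>R e + r *\<^sub>R y = (r * (1 + t)) *\<^sub>R x + (1 - r * (1 + t)) *\<^sub>R e"
          unfolding y_def scaleR_conv_of_real by (simp add: algebra_simps)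
        then show ?thesis using r(3) by simp
      qed
      have "G x \<le> (1 - r) * G e + r * G y"
        using convex_onD[OF conv, of r e y] r xr by auto
      also have "\<dots> \<le> r * G y" using r Ge by (simp add: mult_nonneg_nonpos)
      also have "\<dots> \<le> r * (2 * s * Re (b * y))" using r Gy by simp
      also have "\<dots> < (1 - r) * (2 * s * Re (b * e)) + r * (2 * s * Re (b * y))" using r s be by simp
      also have "\<dots> = 2 * s * Re (b * x)"
        by (subst xr) (simp add: scaleR_conv_of_real algebra_simps)
      finally show False using Gxs by simp
    qed
    then have k: "G z \<le> 2 * s * Re (b * z) \<longleftrightarrow> (cmod z)\<^sup>2 - D \<le> 2 * Re (b * z)" for z
      using k by simp
    have "2 * s * Re (b * y) - G y \<le> 0"
    proof -
      \<comment> \<open>The origin is interior to the disk, so stretching a point of the bounding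
        circle radially leaves the disk. There \<open>G\<close> exceeds the affine function, and
        letting the stretch tend to 1 yields the missing inequality at \<open>y\<close>.\<close>
      define h where "h t = 2 * s * Re (b * (y + of_real t * y)) - G (y + of_real t * y)" for t :: real
      have "h 0 \<le> 0"
      proof (rule continuous_le_zero_at_right)
        show "continuous_on UNIV h" unfolding h_def
          by (intro continuous_intros continuous_on_compose2[OF cont]) auto
        fix t :: real assume t: "t > 0"
        have 1: "cmod (y + of_real t * y) = (1 + t) * cmod y"
        proof -
          have "y + of_real t * y = of_real (1 + t) * y" by (simp add: algebra_simps)
          then show ?thesis using t by (simp only: norm_mult norm_of_real)
        qed
        have 2: "Re (b * (y + of_real t * y)) = (1 + t) * Re (b * y)"
          by (simp add: algebra_simps)
        have "(cmod (y + of_real t * y))\<^sup>2 - D - 2 * Re (b * (y + of_real t * y)) = t * ((1 + t) * (cmod y)\<^sup>2 + D)"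
        proof -
          have "2 * ((1 + t) * Re (b * y)) = (1 + t) * ((cmod y)\<^sup>2 - D)" using bY by (metis mult.left_commute)
          then show ?thesis unfolding 1 2 by (simp add: power2_eq_square algebra_simps)
        qed
        moreover have "t * ((1 + t) * (cmod y)\<^sup>2 + D) > 0"
          using t D by (intro mult_pos_pos add_nonneg_pos) auto
        ultimately show "h t \<le> 0" using k[of "y + of_real t * y"] unfolding h_def by linarith
      qed
      then show ?thesis by (simp add: h_def)
    qed
    moreover have "G y \<le> 2 * s * Re (b * y)" using k[of y] bY by simp
    ultimately have "G y = s * (2 * Re (b * y))" by simp
    then show ?thesis unfolding bY s_def .
  qed
  define r where "r = sqrt D + 1"
  have r: "r > 0" "r\<^sup>2 > D"
  proof -
    show "r > 0" using D by (simp add: r_def add_pos_pos)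
    have "(sqrt D)\<^sup>2 < r\<^sup>2" unfolding r_def using D by (intro power_strict_mono) auto
    then show "r\<^sup>2 > D" using D by simp
  qed
  define \<kappa> where "\<kappa> = G (of_real r) / (r\<^sup>2 - D)"
  have \<kappa>: "\<kappa> > 0" using r G0[of "of_real r"] by (simp add: \<kappa>_def)
  have gen: "G y = \<kappa> * ((cmod y)\<^sup>2 - D)" if "Im y \<noteq> 0" for y
  proof -
    \<comment> \<open>\<open>b\<close> solves the two real linear equations that \<open>key\<close>
      demands at the reference point and at \<open>y\<close>; they are independent because
      \<open>Im y \<noteq> 0\<close>.\<close>
    define p where "p = (r\<^sup>2 - D) / (2 * r)"
    define b where "b = Complex p ((p * Re y - ((cmod y)\<^sup>2 - D) / 2) / Im y)"
    have 1: "2 * Re (b * of_real r) = (cmod (of_real r))\<^sup>2 - D"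
      using r by (simp add: b_def p_def)
    have 2: "2 * Re (b * y) = (cmod y)\<^sup>2 - D"
      using that by (simp add: b_def)
    have "(cmod (of_real r))\<^sup>2 > D" using r by simp
    from key[OF this 1 2] show ?thesis by (simp add: \<kappa>_def)
  qed
  have "G y = \<kappa> * ((cmod y)\<^sup>2 - D)" for y
  proof (cases "Im y = 0")
    case True
    \<comment> \<open>Approaches the real point \<open>y\<close> vertically through non-real
      points.\<close>
    define h where "h t = G (y + of_real t * \<i>) - \<kappa> * ((cmod (y + of_real t * \<i>))\<^sup>2 - D)" for t :: real
    have c: "continuous_on UNIV h" unfolding h_def
      by (intro continuous_intros continuous_on_compose2[OF cont]) auto
    have z: "h t = 0" if "t > 0" for t
      using gen[of "y + of_real t * \<i>"] True that by (simp add: h_def)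
    have "h 0 \<le> 0" using continuous_le_zero_at_right[OF c] z by simp
    moreover have "- h 0 \<le> 0"
      using continuous_le_zero_at_right[of "\<lambda>t. - h t"] c z by (simp add: continuous_on_minus)
    ultimately show ?thesis by (simp add: h_def)
  qed (rule gen)
  then show ?thesis using \<kappa> by blast
qed

text \<open>Translating the centre of one nondegenerate sublevel disk to the origin reduces this to
  the centred case, since the hypothesis is stable under translation and under adding
  constants.\<close>

lemma affine_sublevels_disks_imp_paraboloid:
  fixes g :: "complex \<Rightarrow> real"
  assumes P: "\<And>a b. \<exists>B C. \<forall>z. g z \<le> a + 2 * Re (b * z) \<longleftrightarrow> (cmod z)\<^sup>2 + 2 * Re (B * z) + C \<le> 0"
  shows "\<exists>A B C. A > 0 \<and> (\<forall>z. g z = A * (cmod z)\<^sup>2 + 2 * Re (B * z) + C)"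
proof -
  \<comment> \<open>At this level the sublevel set contains both 0 and 1, so its radius is
    positive.\<close>
  define c where "c = max (g 0) (g 1)"
  obtain B C where BC: "\<And>z. g z \<le> c \<longleftrightarrow> (cmod z)\<^sup>2 + 2 * Re (B * z) + C \<le> 0"
    using P[of c 0] by auto
  define D where "D = (cmod B)\<^sup>2 - C"
  define G where "G z = g (z - cnj B) - c" for z
  have gD: "g z \<le> c \<longleftrightarrow> (cmod (z + cnj B))\<^sup>2 \<le> D" for z
    unfolding BC disk_inequality_iff D_def ..
  have G0: "G z \<le> 0 \<longleftrightarrow> (cmod z)\<^sup>2 \<le> D" for z
    using gD[of "z - cnj B"] by (simp add: G_def)
  have "(cmod (cnj B))\<^sup>2 \<le> D" "(cmod (1 + cnj B))\<^sup>2 \<le> D"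
    using gD[of 0] gD[of 1] by (auto simp: c_def)
  moreover have "cmod (cnj B) > 0 \<or> cmod (1 + cnj B) > 0"
    by (cases "B = 0") auto
  ultimately have D: "D > 0"
    using zero_less_power[of "cmod (cnj B)" 2] zero_less_power[of "cmod (1 + cnj B)" 2] by linarith
  have "\<exists>B' C'. \<forall>z. G z \<le> a + 2 * Re (b * z) \<longleftrightarrow> (cmod z)\<^sup>2 + 2 * Re (B' * z) + C' \<le> 0" for a b
  proof -
    obtain B1 C1 where 1: "\<And>z. g z \<le> (c + a + 2 * Re (b * cnj B)) + 2 * Re (b * z) \<longleftrightarrow> (cmod z)\<^sup>2 + 2 * Re (B1 * z) + C1 \<le> 0"
      using P by blast
    have "G z \<le> a + 2 * Re (b * z) \<longleftrightarrow>
        (cmod z)\<^sup>2 + 2 * Re ((B1 - B) * z) + (C1 + (cmod B)\<^sup>2 - 2 * Re (B1 * cnj B)) \<le> 0" for z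
    proof -
      have "G z \<le> a + 2 * Re (b * z) \<longleftrightarrow> g (z - cnj B) \<le> (c + a + 2 * Re (b * cnj B)) + 2 * Re (b * (z - cnj B))"
        unfolding G_def by (simp add: algebra_simps)
      also have "\<dots> \<longleftrightarrow> (cmod (z - cnj B))\<^sup>2 + 2 * Re (B1 * (z - cnj B)) + C1 \<le> 0" by (rule 1)
      also have "\<dots> \<longleftrightarrow> (cmod z)\<^sup>2 + 2 * Re ((B1 - B) * z) + (C1 + (cmod B)\<^sup>2 - 2 * Re (B1 * cnj B)) \<le> 0"
        unfolding cmod_power2 by (simp add: power2_eq_square algebra_simps)
      finally show ?thesis .
    qed
    then show ?thesis by blast
  qed
  from affine_sublevels_disks_centred[OF this D G0]
  obtain \<kappa> where \<kappa>: "\<kappa> > 0" "\<And>z. G z = \<kappa> * ((cmod z)\<^sup>2 - D)" by blast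
  have "g z = \<kappa> * (cmod z)\<^sup>2 + 2 * Re ((of_real \<kappa> * B) * z) + (c + \<kappa> * ((cmod B)\<^sup>2 - D))" for z
  proof -
    have "g z = c + \<kappa> * ((cmod (z + cnj B))\<^sup>2 - D)" using \<kappa>(2)[of "z + cnj B"] by (simp add: G_def)
    then show ?thesis unfolding cmod_power2 by (simp add: power2_eq_square algebra_simps)
  qed
  then show ?thesis using \<kappa>(1) by blast
qed

section \<open>Hermitian forms\<close>

text \<open>The Jordan-von Neumann argument: in a combination of three instances of the law the
  values at \<open>x - y + z\<close> and \<open>x - y - z\<close> cancel.\<close>

lemma parallelogram_imp_polar_additive:
  fixes q :: "'a::ab_group_add \<Rightarrow> real"
  assumes par: "\<And>x y. q (x + y) + q (x - y) = 2 * q x + 2 * q y"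
  shows "q (x + y + z) - q (x + y) - q z = (q (x + z) - q x - q z) + (q (y + z) - q y - q z)"
proof -
  have "q (x + y + z) + q (x - y + z) = 2 * q (x + z) + 2 * q y"
    using par[of "x + z" y] by (simp add: algebra_simps)
  moreover have "q (x - y + z) + q (x - (y + z)) = 2 * q (x - y) + 2 * q z"
    using par[of "x - y" z] by (simp add: algebra_simps)
  moreover have "q (x + y + z) + q (x - (y + z)) = 2 * q x + 2 * q (y + z)"
    using par[of x "y + z"] by (simp add: algebra_simps)
  ultimately show ?thesis using par[of x y] by linarith
qed

lemma parallelogram_imp_zero:
  fixes q :: "'a::ab_group_add \<Rightarrow> real"
  assumes par: "\<And>x y. q (x + y) + q (x - y) = 2 * q x + 2 * q y"
  shows "q 0 = 0"
  using par[of 0 0] by simp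

text \<open>Polarization turns \<open>q\<close> into a positive definite Hermitian form
  \<open>h\<close>, and Gram-Schmidt yields an \<open>h\<close>-orthonormal basis, the columns of
  \<open>E\<close>. Real homogeneity of the polar form is the hypothesis \<open>polar_hom\<close>,
  in place of a continuity argument.\<close>

lemma positive_hermitian_form_diagonalizable:
  fixes q :: "complex ^ 'n \<Rightarrow> real"
  assumes par: "\<And>x y. q (x + y) + q (x - y) = 2 * q x + 2 * q y"
    and hom: "\<And>c x. q (c *s x) = (cmod c)\<^sup>2 * q x"
    and polar_hom: "\<And>t x y. q (complex_of_real t *s x + y) - q (complex_of_real t *s x) - q y = t * (q (x + y) - q x - q y)"
    and pos: "\<And>x. x \<noteq> 0 \<Longrightarrow> q x > 0"
  shows "\<exists>E :: complex ^ 'n ^ 'n. invertible E \<and> (\<forall>z. q (E *v z) = (norm z)\<^sup>2)"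
proof -
  define R where "R x y = (q (x + y) - q x - q y) / 2" for x y
  \<comment> \<open>With this sign of the imaginary part \<open>h\<close> is complex linear in its
    first argument.\<close>
  define h where "h x y = Complex (R x y) (R x (\<i> *s y))" for x y
  have R_sym: "R x y = R y x" for x y by (simp add: R_def add.commute)
  have R_add: "R (x + y) z = R x z + R y z" for x y z
    using parallelogram_imp_polar_additive[OF par, of x y z]
    unfolding R_def add_divide_distrib[symmetric] by (rule arg_cong)
  have R_real: "R (of_real t *s x) y = t * R x y" for t x y
    using polar_hom[of t x y] by (simp add: R_def)
  have R_i: "R (\<i> *s x) (\<i> *s y) = R x y" for x y
    by (simp add: R_def hom flip: vector_add_ldistrib)
  have R_i1: "R (\<i> *s x) y = - R x (\<i> *s y)" for x y
  proof -
    have "R (\<i> *s x) y = R (\<i> *s (\<i> *s x)) (\<i> *s y)" by (simp only: R_i)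
    also have "\<i> *s (\<i> *s x) = of_real (-1) *s x" by (simp add: vector_smult_assoc)
    finally show ?thesis by (simp only: R_real)
  qed
  have h_add: "h (x + y) z = h x z + h y z" for x y z
    by (simp add: h_def R_add complex_eq_iff)
  have h_scale: "h (c *s x) y = c * h x y" for c x y
  proof -
    have c: "c *s x = of_real (Re c) *s x + of_real (Im c) *s (\<i> *s x)"
      by (simp add: vec_eq_iff complex_eq_iff)
    have "R (c *s x) z = Re c * R x z - Im c * R x (\<i> *s z)" for z
      by (subst c) (simp only: R_add R_real R_i1)
    moreover have "R x (\<i> *s (\<i> *s y)) = - R x y"
      using R_i1[of x "\<i> *s y"] R_i by simp
    ultimately show ?thesis by (simp add: h_def complex_eq_iff)
  qed
  have h_cnj: "h y x = cnj (h x y)" for x y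
    using R_i1[of x y] R_sym by (simp add: h_def complex_eq_iff)
  have h_q: "h x x = of_real (q x)" for x
  proof -
    have "x + x = of_real 2 *s x" by (simp add: vec_eq_iff)
    then have "q (x + x) = 4 * q x" by (simp add: hom)
    moreover have "x + \<i> *s x = (1 + \<i>) *s x" by (simp add: vec_eq_iff algebra_simps)
    then have "q (x + \<i> *s x) = 2 * q x" by (simp only: hom cmod_power2) simp
    ultimately show ?thesis by (simp add: h_def R_def hom complex_eq_iff)
  qed
  have h_sum: "h (\<Sum>i\<in>S. f i) y = (\<Sum>i\<in>S. h (f i) y)" for S :: "'n set" and f y
  proof -
    have "h 0 y = 0" using h_scale[of 0 0 y] by simp
    then show ?thesis
      by (induction S rule: infinite_finite_induct) (simp_all add: h_add)
  qed
  \<comment> \<open>Gram-Schmidt, one coordinate at a time. As the earlier vectors vanish at the new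
    coordinate \<open>j\<close>, the corrected axis vector keeps entry 1 there; it is nonzero and
    can be normalized.\<close>
  have "\<exists>e. \<forall>i\<in>S. (\<forall>k. k \<notin> S \<longrightarrow> e i $ k = 0) \<and> (\<forall>j\<in>S. h (e i) (e j) = (if i = j then 1 else 0))"
    if "finite S" for S :: "'n set"
    using that
  proof (induction S rule: finite_induct)
    case empty
    then show ?case by simp
  next
    case (insert j S)
    then obtain e where supp: "\<And>i k. i \<in> S \<Longrightarrow> k \<notin> S \<Longrightarrow> e i $ k = 0"
      and orth: "\<And>i k. i \<in> S \<Longrightarrow> k \<in> S \<Longrightarrow> h (e i) (e k) = (if i = k then 1 else 0)" by blast
    define a :: "complex ^ 'n" where "a = axis j 1"
    define x where "x = a + (\<Sum>i\<in>S. (- h a (e i)) *s e i)"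
    have xk: "x $ k = a $ k" if "k \<notin> S" for k
      using supp that by (simp add: x_def sum_component)
    then have "x $ j = 1" using insert.hyps by (simp add: a_def axis_def)
    then have "x \<noteq> 0" by auto
    then have qx: "q x > 0" by (rule pos)
    have xe: "h x (e k) = 0" if "k \<in> S" for k
    proof -
      have "h x (e k) = h a (e k) + (\<Sum>i\<in>S. - h a (e i) * h (e i) (e k))"
        by (simp only: x_def h_add h_sum h_scale)
      also have "(\<Sum>i\<in>S. - h a (e i) * h (e i) (e k)) = (\<Sum>i\<in>S. if i = k then - h a (e k) else 0)"
        using orth that by (intro sum.cong) auto
      finally show ?thesis using that insert.hyps by simp
    qed
    define y where "y = of_real (1 / sqrt (q x)) *s x"
    have ye: "h y (e k) = 0" "h (e k) y = 0" if "k \<in> S" for k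
      using xe[OF that] h_cnj[of "e k" y] by (simp_all only: y_def h_scale) auto
    have yy: "h y y = 1"
      using qx by (simp add: h_q y_def hom power_divide norm_divide)
    have ysupp: "y $ k = 0" if "k \<notin> insert j S" for k
      using xk[of k] that by (simp add: y_def a_def axis_def)
    have "\<forall>i\<in>insert j S. (\<forall>k. k \<notin> insert j S \<longrightarrow> (e(j := y)) i $ k = 0) \<and>
        (\<forall>k\<in>insert j S. h ((e(j := y)) i) ((e(j := y)) k) = (if i = k then 1 else 0))"
      using insert.hyps ye yy ysupp supp orth by auto
    then show ?case by blast
  qed
  from this[of UNIV] obtain e where "\<forall>i j :: 'n. h (e i) (e j) = (if i = j then 1 else 0)" by auto
  then have e: "h (e i) (e j) = (if i = j then 1 else 0)" for i j :: 'n by blast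
  define E :: "complex ^ 'n ^ 'n" where "E = (\<chi> i j. e j $ i)"
  have Ez: "E *v z = (\<Sum>i\<in>UNIV. z $ i *s e i)" for z
    by (simp add: E_def vec_eq_iff matrix_vector_mult_def mult.commute)
  have qE: "q (E *v z) = (norm z)\<^sup>2" for z
  proof -
    have 1: "h (e i) (E *v z) = cnj (z $ i)" for i
    proof -
      have "h (E *v z) (e i) = (\<Sum>j\<in>UNIV. if j = i then z $ j else 0)"
        unfolding Ez by (simp only: h_sum h_scale e) (intro sum.cong, auto)
      then show ?thesis using h_cnj[of "e i" "E *v z"] by simp
    qed
    have "of_real (q (E *v z)) = h (E *v z) (E *v z)" by (simp only: h_q)
    also have "\<dots> = (\<Sum>i\<in>UNIV. z $ i * cnj (z $ i))"
    proof -
      have "h (E *v z) v = (\<Sum>i\<in>UNIV. z $ i * h (e i) v)" for v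
        unfolding Ez by (simp only: h_sum h_scale)
      then show ?thesis by (simp only: 1)
    qed
    also have "\<dots> = of_real ((norm z)\<^sup>2)"
      by (simp add: norm_vec_def L2_set_def sum_nonneg complex_norm_square[symmetric])
    finally show ?thesis by (simp only: of_real_eq_iff)
  qed
  have "inj ((*v) E)"
  proof (rule injI)
    fix x y assume "E *v x = E *v y"
    then have "E *v (x - y) = 0" by (simp add: matrix_vector_mult_diff_distrib)
    then have "(norm (x - y))\<^sup>2 = 0"
      using qE[of "x - y"] parallelogram_imp_zero[OF par] by simp
    then show "x = y" by simp
  qed
  then have "invertible E"
    using matrix_left_invertible_injective invertible_left_inverse by blast
  then show ?thesis using qE by blast
qed

text \<open>Two vectors not both in the hyperplane lie in a span of some \<open>u\<close> and
  \<open>w\<close> as in \<open>form\<close>, where the identities are computations with a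
  two-variable Hermitian polynomial. What remains is to define \<open>q\<close> on the hyperplane
  consistently and to treat pairs inside it by shifting with \<open>u0\<close>.\<close>

lemma hermitian_form_extends_from_hyperplane_complement:
  fixes \<phi> :: "complex ^ 'n \<Rightarrow> complex" and \<alpha> :: "complex ^ 'n \<Rightarrow> real"
  assumes \<phi>_add: "\<And>x y. \<phi> (x + y) = \<phi> x + \<phi> y" and \<phi>_scale: "\<And>c x. \<phi> (c *s x) = c * \<phi> x"
    and u0: "\<phi> u0 \<noteq> 0"
    and form: "\<And>u w. \<phi> u \<noteq> 0 \<Longrightarrow> \<phi> w = 0 \<Longrightarrow> \<exists>A B C. (w \<noteq> 0 \<longrightarrow> A > 0) \<and>
      (\<forall>s t. s \<noteq> 0 \<longrightarrow> \<alpha> (s *s u + t *s w) = A * (cmod t)\<^sup>2 + 2 * Re (B * t * cnj s) + C * (cmod s)\<^sup>2)"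
    and \<alpha>_pos: "\<And>u. \<phi> u \<noteq> 0 \<Longrightarrow> \<alpha> u > 0"
  shows "\<exists>q. (\<forall>v. \<phi> v \<noteq> 0 \<longrightarrow> q v = \<alpha> v) \<and>
    (\<forall>x y. q (x + y) + q (x - y) = 2 * q x + 2 * q y) \<and>
    (\<forall>c x. q (c *s x) = (cmod c)\<^sup>2 * q x) \<and>
    (\<forall>t x y. q (complex_of_real t *s x + y) - q (complex_of_real t *s x) - q y = t * (q (x + y) - q x - q y)) \<and>
    (\<forall>x. x \<noteq> 0 \<longrightarrow> q x > 0)"
proof -
  have \<phi>_minus: "\<phi> (- x) = - \<phi> x" for x
    using \<phi>_scale[of "-1" x] by simp
  have \<phi>_diff: "\<phi> (x - y) = \<phi> x - \<phi> y" for x y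
    using \<phi>_add[of x "- y"] by (simp add: \<phi>_minus)
  note \<phi> = \<phi>_add \<phi>_scale \<phi>_minus \<phi>_diff
  have \<phi>0: "\<phi> 0 = 0" using \<phi>_scale[of 0 0] by simp
  have decomp: "\<exists>l w. \<phi> w = 0 \<and> y = l *s x + w" if "\<phi> x \<noteq> 0" for x y
    using that by (intro exI[of _ "\<phi> y / \<phi> x"] exI[of _ "y - (\<phi> y / \<phi> x) *s x"]) (simp add: \<phi>)
  have \<alpha>_even: "\<alpha> (- u) = \<alpha> u" if u: "\<phi> u \<noteq> 0" for u
  proof -
    obtain A B C where "\<forall>s t. s \<noteq> 0 \<longrightarrow> \<alpha> (s *s u + t *s 0) = A * (cmod t)\<^sup>2 + 2 * Re (B * t * cnj s) + C * (cmod s)\<^sup>2"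
      using form[OF u \<phi>0] by blast
    from this[rule_format, of "-1" 0] this[rule_format, of 1 0] show ?thesis by simp
  qed
  \<comment> \<open>The restrictions on \<open>y\<close> keep \<open>x + y\<close> and
    \<open>x - y\<close> off the hyperplane, where \<open>form\<close> describes \<alpha>.\<close>
  have \<alpha>_par: "\<alpha> (x + y) + \<alpha> (x - y) = 2 * \<alpha> x + 2 * \<alpha> y"
    if x: "\<phi> x \<noteq> 0" and y: "\<phi> y \<noteq> 0" and ne: "\<phi> y \<noteq> \<phi> x" "\<phi> y \<noteq> - \<phi> x" for x y
  proof -
    obtain l w where w: "\<phi> w = 0" and yl: "y = l *s x + w" using decomp[OF x] by blast
    have l: "l \<noteq> 0" "1 + l \<noteq> 0" "1 - l \<noteq> 0"
      using y ne x w by (auto simp: yl \<phi> add_eq_0_iff)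
    obtain A B C where F: "\<And>s t. s \<noteq> 0 \<Longrightarrow> \<alpha> (s *s x + t *s w) = A * (cmod t)\<^sup>2 + 2 * Re (B * t * cnj s) + C * (cmod s)\<^sup>2"
      using form[OF x w] by blast
    have e: "x + y = (1 + l) *s x + 1 *s w" "x - y = (1 - l) *s x + (-1) *s w" "y = l *s x + 1 *s w" "x = 1 *s x + 0 *s w"
      by (simp_all add: yl vec_eq_iff algebra_simps)
    have "\<alpha> (x + y) = A + 2 * Re (B * cnj (1 + l)) + C * (cmod (1 + l))\<^sup>2"
       "\<alpha> (x - y) = A + 2 * Re (- B * cnj (1 - l)) + C * (cmod (1 - l))\<^sup>2"
       "\<alpha> y = A + 2 * Re (B * cnj l) + C * (cmod l)\<^sup>2" "\<alpha> x = C"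
      using F[of "1 + l" 1, folded e(1)] F[of "1 - l" "-1", folded e(2)] F[of l 1, folded e(3)] F[of 1 0, folded e(4)] l by simp_all
    then show ?thesis unfolding cmod_power2 by (simp add: power2_eq_square algebra_simps)
  qed
  \<comment> \<open>For a quadratic form this second difference is twice the value at
    \<open>w\<close>, whatever \<open>u\<close> is. Half of it is therefore the candidate value on
    the hyperplane.\<close>
  define \<Delta> where "\<Delta> u w = \<alpha> (u + w) + \<alpha> (u - w) - 2 * \<alpha> u" for u w
  have \<Delta>_scale: "\<Delta> (c *s u) w = \<Delta> u w" if u: "\<phi> u \<noteq> 0" and w: "\<phi> w = 0" and c: "c \<noteq> 0" for c u w
  proof -
    obtain A B C where F: "\<And>s t. s \<noteq> 0 \<Longrightarrow> \<alpha> (s *s u + t *s w) = A * (cmod t)\<^sup>2 + 2 * Re (B * t * cnj s) + C * (cmod s)\<^sup>2"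
      using form[OF u w] by blast
    have "\<Delta> (s *s u) w = 2 * A" if "s \<noteq> 0" for s
      using F[OF that, of 1] F[OF that, of "-1"] F[OF that, of 0] by (simp add: \<Delta>_def)
    from this[of c] this[of 1] c show ?thesis by simp
  qed
  text \<open>The left-hand side below is symmetric in \<open>u\<close> and \<open>u'\<close>, whence \<open>\<Delta>\<close> does not depend on its
    first argument.\<close>
  have \<Delta>_half: "\<Delta> (u + u') w + \<Delta> (u - u') w = 2 * \<Delta> u w"
    if "\<phi> u \<noteq> 0" "\<phi> u' \<noteq> 0" "\<phi> w = 0" "\<phi> u' \<noteq> \<phi> u" "\<phi> u' \<noteq> - \<phi> u" for u u' w
    using \<alpha>_par[of "u + w" u'] \<alpha>_par[of "u - w" u'] \<alpha>_par[of u u'] that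
    by (simp add: \<Delta>_def \<phi> algebra_simps)
  have \<Delta>_indep: "\<Delta> u w = \<Delta> u' w" if u: "\<phi> u \<noteq> 0" and u': "\<phi> u' \<noteq> 0" and w: "\<phi> w = 0" for u u' w
  proof -
    \<comment> \<open>Rescaling \<open>u'\<close> to \<open>v\<close> with
      \<open>\<phi> v = 2 * \<phi> u\<close> keeps \<open>u + v\<close> and \<open>u - v\<close> off
      the hyperplane.\<close>
    define c where "c = 2 * \<phi> u / \<phi> u'"
    define v where "v = c *s u'"
    have c: "c \<noteq> 0" using u u' by (simp add: c_def)
    have v: "\<phi> v = 2 * \<phi> u" using u' by (simp add: v_def c_def \<phi>)
    have ne: "2 * \<phi> u \<noteq> \<phi> u" "2 * \<phi> u \<noteq> - \<phi> u" "\<phi> u \<noteq> - (2 * \<phi> u)"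
      using u by (auto simp: complex_eq_iff)
    have "\<Delta> (u - v) w = \<Delta> (v - u) w"
      using \<Delta>_scale[of "v - u" w "-1"] w u by (simp add: \<phi> v)
    then have "\<Delta> u w = \<Delta> v w"
      using \<Delta>_half[of u v w] \<Delta>_half[of v u w] u w v ne by (simp add: add.commute)
    also have "\<dots> = \<Delta> u' w" unfolding v_def by (rule \<Delta>_scale[OF u' w c])
    finally show ?thesis .
  qed
  define q where "q v = (if \<phi> v \<noteq> 0 then \<alpha> v else \<Delta> u0 v / 2)" for v
  have F: "\<exists>A B C. (w \<noteq> 0 \<longrightarrow> A > 0) \<and>
      (\<forall>s t. q (s *s u + t *s w) = A * (cmod t)\<^sup>2 + 2 * Re (B * t * cnj s) + C * (cmod s)\<^sup>2)"
    if u: "\<phi> u \<noteq> 0" and w: "\<phi> w = 0" for u w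
  proof -
    obtain A B C where A: "w \<noteq> 0 \<longrightarrow> A > 0"
      and F: "\<And>s t. s \<noteq> 0 \<Longrightarrow> \<alpha> (s *s u + t *s w) = A * (cmod t)\<^sup>2 + 2 * Re (B * t * cnj s) + C * (cmod s)\<^sup>2"
      using form[OF u w] by blast
    have "q (s *s u + t *s w) = A * (cmod t)\<^sup>2 + 2 * Re (B * t * cnj s) + C * (cmod s)\<^sup>2" for s t
    proof (cases "s = 0")
      case True
      \<comment> \<open>The second difference at \<open>s = 1\<close> cancels the \<open>B\<close>
        and \<open>C\<close> terms, so the formula persists for \<open>s = 0\<close>.\<close>
      have "q (t *s w) = \<Delta> u (t *s w) / 2"
        using \<Delta>_indep[OF u0 u, of "t *s w"] w by (simp add: q_def \<phi>)
      also have "\<dots> = A * (cmod t)\<^sup>2"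
        using F[of 1 t] F[of 1 "-t"] F[of 1 0] by (simp add: \<Delta>_def)
      finally show ?thesis using True by simp
    next
      case False
      then show ?thesis using F[OF False, of t] u w by (simp add: q_def \<phi>)
    qed
    with A show ?thesis by blast
  qed
  have hom: "q (c *s x) = (cmod c)\<^sup>2 * q x" for c x
  proof (cases "\<phi> x = 0")
    case True
    obtain A B C where "\<And>s t. q (s *s u0 + t *s x) = A * (cmod t)\<^sup>2 + 2 * Re (B * t * cnj s) + C * (cmod s)\<^sup>2"
      using F[OF u0 True] by blast
    from this[of 0 c] this[of 0 1] show ?thesis by simp
  next
    case False
    obtain A B C where "\<And>s t. q (s *s x + t *s 0) = A * (cmod t)\<^sup>2 + 2 * Re (B * t * cnj s) + C * (cmod s)\<^sup>2"
      using F[OF False \<phi>0] by blast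
    from this[of c 0] this[of 1 0] show ?thesis by simp
  qed
  have even: "q (- x) = q x" for x using hom[of "-1" x] by simp
  have par1: "q (x + y) + q (x - y) = 2 * q x + 2 * q y" if x: "\<phi> x \<noteq> 0" for x y
  proof -
    obtain l w where w: "\<phi> w = 0" and yl: "y = l *s x + w" using decomp[OF x] by blast
    obtain A B C where F: "\<And>s t. q (s *s x + t *s w) = A * (cmod t)\<^sup>2 + 2 * Re (B * t * cnj s) + C * (cmod s)\<^sup>2"
      using F[OF x w] by blast
    have e: "x + y = (1 + l) *s x + 1 *s w" "x - y = (1 - l) *s x + (-1) *s w" "y = l *s x + 1 *s w" "x = 1 *s x + 0 *s w"
      by (simp_all add: yl vec_eq_iff algebra_simps)
    have "q (x + y) = A + 2 * Re (B * cnj (1 + l)) + C * (cmod (1 + l))\<^sup>2"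
       "q (x - y) = A + 2 * Re (- B * cnj (1 - l)) + C * (cmod (1 - l))\<^sup>2"
       "q y = A + 2 * Re (B * cnj l) + C * (cmod l)\<^sup>2" "q x = C"
      using F[of "1 + l" 1, folded e(1)] F[of "1 - l" "-1", folded e(2)] F[of l 1, folded e(3)] F[of 1 0, folded e(4)] by simp_all
    then show ?thesis unfolding cmod_power2 by (simp add: power2_eq_square algebra_simps)
  qed
  have par2: "q (x + y) + q (x - y) = 2 * q x + 2 * q y" if "\<phi> y \<noteq> 0" for x y
    using par1[OF that, of x] even[of "x - y"] by (simp add: add.commute)
  have par: "q (x + y) + q (x - y) = 2 * q x + 2 * q y" for x y
  proof (cases "\<phi> x = 0 \<and> \<phi> y = 0")
    case True
    \<comment> \<open>Sum the law over the shifts of \<open>x\<close> by \<open>u0\<close> and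
      \<open>- u0\<close>, then remove \<open>u0\<close> by instances whose second vector is
      \<open>u0\<close>.\<close>
    have "q (x + u0 + y) + q (x + u0 - y) = 2 * q (x + u0) + 2 * q y"
         "q (x - u0 + y) + q (x - u0 - y) = 2 * q (x - u0) + 2 * q y"
      using True u0 by (auto intro!: par1 simp: \<phi>)
    moreover have "q (x + y + u0) + q (x + y - u0) = 2 * q (x + y) + 2 * q u0"
       "q (x - y + u0) + q (x - y - u0) = 2 * q (x - y) + 2 * q u0"
       "q (x + u0) + q (x - u0) = 2 * q x + 2 * q u0"
      using u0 by (auto intro: par2)
    ultimately show ?thesis by (simp add: algebra_simps)
  qed (use par1 par2 in blast)
  have polar1: "q (of_real t *s x + y) - q (of_real t *s x) - q y = t * (q (x + y) - q x - q y)"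
    if x: "\<phi> x \<noteq> 0" for t x y
  proof -
    obtain l w where w: "\<phi> w = 0" and yl: "y = l *s x + w" using decomp[OF x] by blast
    obtain A B C where F: "\<And>s t. q (s *s x + t *s w) = A * (cmod t)\<^sup>2 + 2 * Re (B * t * cnj s) + C * (cmod s)\<^sup>2"
      using F[OF x w] by blast
    have e: "x + y = (1 + l) *s x + 1 *s w" "of_real t *s x + y = (of_real t + l) *s x + 1 *s w"
         "y = l *s x + 1 *s w" "x = 1 *s x + 0 *s w" "of_real t *s x = of_real t *s x + 0 *s w"
      by (simp_all add: yl vec_eq_iff algebra_simps)
    have "q (x + y) = A + 2 * Re (B * cnj (1 + l)) + C * (cmod (1 + l))\<^sup>2"
       "q (of_real t *s x + y) = A + 2 * Re (B * cnj (of_real t + l)) + C * (cmod (of_real t + l))\<^sup>2"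
       "q y = A + 2 * Re (B * cnj l) + C * (cmod l)\<^sup>2" "q x = C" "q (of_real t *s x) = C * t\<^sup>2"
      using F[of "1 + l" 1, folded e(1)] F[of "of_real t + l" "1", folded e(2)] F[of l 1, folded e(3)]
        F[of 1 0, folded e(4)] F[of "of_real t" 0, folded e(5)] by simp_all
    then show ?thesis unfolding cmod_power2 by (simp add: power2_eq_square algebra_simps)
  qed
  have polar: "q (of_real t *s x + y) - q (of_real t *s x) - q y = t * (q (x + y) - q x - q y)" for t x y
  proof (cases "\<phi> x = 0")
    case True
    \<comment> \<open>By additivity of the polar form, the claim for \<open>x\<close> is the claim
      for \<open>x + u0\<close> minus that for \<open>u0\<close>, both off the hyperplane.\<close>
    have "q (of_real t *s (x + u0) + y) - q (of_real t *s (x + u0)) - q y = t * (q (x + u0 + y) - q (x + u0) - q y)"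
      using True u0 by (intro polar1) (simp add: \<phi>)
    then have "q (of_real t *s x + of_real t *s u0 + y) - q (of_real t *s x + of_real t *s u0) - q y = t * (q (x + u0 + y) - q (x + u0) - q y)"
      by (simp only: vector_add_ldistrib)
    then show ?thesis
      using polar1[OF u0, of t y]
      unfolding parallelogram_imp_polar_additive[of q, OF par] by (simp add: algebra_simps)
  qed (rule polar1)
  have pos: "q x > 0" if x: "x \<noteq> 0" for x
  proof (cases "\<phi> x = 0")
    case True
    obtain A B C where "A > 0" "\<And>s t. q (s *s u0 + t *s x) = A * (cmod t)\<^sup>2 + 2 * Re (B * t * cnj s) + C * (cmod s)\<^sup>2"
      using F[OF u0 True] x by blast
    from this(1) this(2)[of 0 1] show ?thesis by simp
  qed (use \<alpha>_pos in \<open>simp add: q_def\<close>)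
  show ?thesis
    by (intro exI[of _ q] conjI allI impI) (use hom par polar pos in \<open>auto simp: q_def\<close>)
qed

section \<open>Bodies with disk sections\<close>

lemma norm_vector_scalar_mult: "norm (c *s x) = cmod c * norm x" for x :: "complex ^ 'n"
  by (simp add: norm_vec_def norm_mult L2_set_right_distrib)

lemma Re_of_real_mult: "Re (of_real r * z) = r * Re z"
  by simp

text \<open>The disk contains 0 and lies in a half-plane bounded by a line through 0, so it touches
  that line at 0. Testing its extreme point \<open>c + e\<close> in the direction
  \<open>cnj b\<close> gives \<open>(cmod (c + e))\<^sup>2 \<le> 0\<close>.\<close>

lemma disk_tangent_to_half_plane:
  assumes "r > 0" "b \<noteq> 0" and c: "cmod c \<le> r"
    and half: "\<And>z. cmod (z - c) \<le> r \<Longrightarrow> Re (z * b) \<le> 0"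
  shows "c = - of_real (r / cmod b) * cnj b"
proof -
  have bb: "cnj b * b = of_real ((cmod b)\<^sup>2)" by (simp only: complex_norm_square mult.commute)
  define e where "e = of_real (r / cmod b) * cnj b"
  have e: "cmod e = r" using assms(1,2) by (simp add: e_def norm_mult norm_divide)
  have "Re ((c + e) * b) \<le> 0" by (rule half) (simp add: e)
  moreover have "e * b = of_real (r / cmod b) * of_real ((cmod b)\<^sup>2)" by (simp only: e_def mult.assoc bb)
  then have "Re (e * b) = r * cmod b"
    using assms(2) by (simp add: power2_eq_square flip: of_real_mult of_real_divide)
  ultimately have cb: "Re (c * b) \<le> - r * cmod b" by (simp add: distrib_right del: times_complex.sel)
  have "(cmod (c + e))\<^sup>2 = (cmod c)\<^sup>2 + (cmod e)\<^sup>2 + 2 * (r / cmod b) * Re (c * b)"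
    unfolding cmod_power2 by (simp add: e_def power2_eq_square algebra_simps)
  also have "\<dots> \<le> r\<^sup>2 + r\<^sup>2 + 2 * (r / cmod b) * (- r * cmod b)"
    using cb assms(1,2) c by (intro add_mono mult_left_mono power_mono) (auto simp: e)
  also have "\<dots> = 0" using assms(2) by (simp add: power2_eq_square)
  finally have "c + e = 0" by simp
  then show ?thesis by (simp add: e_def eq_neg_iff_add_eq_0)
qed

text \<open>A body whose complex line sections are disks, moved so that the origin is a boundary point
  at which the body lies inside a ball tangent to the complex hyperplane \<open>\<phi> = 0\<close>.\<close>

locale disk_section_body =
  fixes K :: "(complex ^ 'n) set" and \<phi> :: "complex ^ 'n \<Rightarrow> complex"
  assumes \<phi>_add: "\<phi> (x + y) = \<phi> x + \<phi> y" and \<phi>_scale: "\<phi> (c *s x) = c * \<phi> x"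
    and convex: "convex K" and zero_mem: "0 \<in> K" and interior: "interior K \<noteq> {}"
    and in_ball: "v \<in> K \<Longrightarrow> (norm v)\<^sup>2 + 2 * Re (\<phi> v) \<le> 0"
    and line_section: "v \<noteq> 0 \<Longrightarrow>
      \<exists>B C. \<forall>z. x + z *s v \<in> K \<longleftrightarrow> (cmod z)\<^sup>2 + 2 * Re (B * z) + C \<le> 0"
begin

lemma \<phi>_zero: "\<phi> 0 = 0"
  using \<phi>_scale[of 0 0] by simp

lemma \<phi>_diff: "\<phi> (x - y) = \<phi> x - \<phi> y"
  using \<phi>_add[of x "- y"] \<phi>_scale[of "-1" y] by simp

text \<open>The second point \<open>z0\<close> makes the disk nondegenerate, and
  \<open>in_ball\<close> confines it to the half-plane \<open>Re (z * \<phi> v) \<le> 0\<close>.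
  Tangency at 0 leaves only the radius free, which \<open>a\<close> records.\<close>

lemma section_through_zero:
  assumes v: "\<phi> v \<noteq> 0" and z0: "z0 \<noteq> 0" "z0 *s v \<in> K"
  shows "\<exists>a>0. \<forall>z. z *s v \<in> K \<longleftrightarrow> a * (cmod z)\<^sup>2 + 2 * Re (z * \<phi> v) \<le> 0"
proof -
  have "v \<noteq> 0" using v \<phi>_zero by auto
  from line_section[OF this, of 0] obtain B C
    where BC: "\<And>z. z *s v \<in> K \<longleftrightarrow> (cmod (z + cnj B))\<^sup>2 \<le> (cmod B)\<^sup>2 - C"
    unfolding disk_inequality_iff by auto
  define D where "D = (cmod B)\<^sup>2 - C"
  have mem: "(cmod (cnj B))\<^sup>2 \<le> D" "(cmod (z0 + cnj B))\<^sup>2 \<le> D"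
    using BC[of 0] BC[of z0] z0 zero_mem by (auto simp: D_def)
  have "cmod (cnj B) > 0 \<or> cmod (z0 + cnj B) > 0" using z0 by (cases "B = 0") auto
  then have D: "D > 0"
    using mem zero_less_power[of "cmod (cnj B)" 2] zero_less_power[of "cmod (z0 + cnj B)" 2] by linarith
  have KD: "z *s v \<in> K \<longleftrightarrow> cmod (z - (- cnj B)) \<le> sqrt D" for z
    using BC[of z] D unfolding D_def by (simp add: real_le_rsqrt sqrt_ge_absD) (metis abs_norm_cancel real_sqrt_abs real_sqrt_le_iff)
  have "- cnj B = - of_real (sqrt D / cmod (\<phi> v)) * cnj (\<phi> v)"
  proof (rule disk_tangent_to_half_plane)
    show "sqrt D > 0" using D by simp
    show "cmod (- cnj B) \<le> sqrt D" using KD[of 0] zero_mem by simp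
    fix z assume "cmod (z - (- cnj B)) \<le> sqrt D"
    then have "z *s v \<in> K" using KD by blast
    from in_ball[OF this] show "Re (z * \<phi> v) \<le> 0"
      unfolding \<phi>_scale by (smt (verit) zero_le_power2)
  qed (rule v)
  then have "cnj B = cnj (of_real (sqrt D / cmod (\<phi> v)) * \<phi> v)" by simp
  then have B: "B = of_real (sqrt D / cmod (\<phi> v)) * \<phi> v" by (simp only: complex_cnj_cancel_iff)
  then have "cmod B = sqrt D" using v D by (simp add: norm_mult norm_divide)
  then have "(cmod B)\<^sup>2 = D" using D by (metis less_imp_le real_sqrt_pow2)
  then have C: "C = 0" by (simp add: D_def)
  define a where "a = cmod (\<phi> v) / sqrt D"
  have a: "a > 0" using v D by (simp add: a_def)
  have "z *s v \<in> K \<longleftrightarrow> a * (cmod z)\<^sup>2 + 2 * Re (z * \<phi> v) \<le> 0" for z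
  proof -
    have "Re (B * z) = 1 / a * Re (z * \<phi> v)"
      unfolding B mult.assoc mult.commute[of "\<phi> v"] Re_of_real_mult by (simp add: a_def)
    then have "a * ((cmod z)\<^sup>2 + 2 * Re (B * z) + C) = a * (cmod z)\<^sup>2 + 2 * Re (z * \<phi> v)"
      using a by (simp add: C distrib_left del: times_complex.sel)
    moreover have "z *s v \<in> K \<longleftrightarrow> a * ((cmod z)\<^sup>2 + 2 * Re (B * z) + C) \<le> 0"
      unfolding BC disk_inequality_iff[symmetric] using a by (simp add: mult_le_0_iff not_less)
    ultimately show ?thesis by simp
  qed
  with a show ?thesis by blast
qed

text \<open>Rules out that a transversal line meets \<open>K\<close> only at 0. Sections through
  points near an interior point are nondegenerate, and convexity carries this over to all other
  directions.\<close>

lemma ray_meets_body: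
  assumes v: "Re (\<phi> v) < 0"
  shows "\<exists>r>0. of_real r *s v \<in> K"
proof -
  obtain x0 e where e: "e > 0" and x0: "ball x0 e \<subseteq> K"
    using interior by (meson ex_in_conv mem_interior)
  have v0: "v \<noteq> 0" using v \<phi>_zero by auto
  have "x0 \<noteq> 0"
  proof
    assume "x0 = 0"
    define y where "y = of_real (e / (2 * norm v)) *s v"
    have "norm y = \<bar>e / (2 * norm v)\<bar> * norm v"
      by (simp only: y_def norm_vector_scalar_mult norm_of_real)
    then have ny: "norm y = e / 2" using v0 e by simp
    have "y \<in> K" "(-1) *s y \<in> K" using x0 ny e by (auto simp: \<open>x0 = 0\<close> subset_iff)
    then have "(norm y)\<^sup>2 + 2 * Re (\<phi> y) \<le> 0" "(norm y)\<^sup>2 - 2 * Re (\<phi> y) \<le> 0"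
      using in_ball[of y] in_ball[of "(-1) *s y"] by (simp_all only: \<phi>_scale) auto
    then have "(norm y)\<^sup>2 \<le> 0" by linarith
    then show False using ny e by simp
  qed
  then have "Re (\<phi> x0) < 0"
    using in_ball[of x0] x0 e zero_less_power[of "norm x0" 2] by (simp add: subset_iff) (smt (verit) zero_less_norm_iff zero_less_power)
  then have px: "\<phi> x0 \<noteq> 0" by auto
  define c where "c = \<phi> v / \<phi> x0"
  define h where "h = v - c *s x0"
  have ph: "\<phi> h = 0" using px by (simp add: h_def \<phi>_diff \<phi>_scale c_def)
  \<comment> \<open>Large enough to make \<open>(1 / z s) *s h\<close> shorter than
    \<open>e\<close>. The shift in \<open>z s\<close> changes \<open>z s * \<phi> x0\<close> only by
    an imaginary number, so its real part stays \<open>Re (\<phi> v) < 0\<close>.\<close>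
  define T where "T = cmod (\<phi> x0) * (cmod c + (norm h + 1) / e)"
  define z where "z s = c + of_real (s * T) * \<i> / \<phi> x0" for s
  text \<open>For large \<open>T\<close> the vectors \<open>z s *s x0 + h\<close> are complex multiples of points near \<open>x0\<close>, so the
    section argument applies to them, and \<open>v\<close> is their midpoint for \<open>s = 1\<close> and \<open>s = -1\<close>.\<close>
  have small: "\<exists>r0>0. \<forall>r. 0 < r \<and> r \<le> r0 \<longrightarrow> of_real r *s (z s *s x0 + h) \<in> K" if s: "\<bar>s\<bar> = 1" for s
  proof -
    have T: "T > 0" using px e by (simp add: T_def add_nonneg_pos add_pos_nonneg)
    have "cmod (of_real (s * T) * \<i> / \<phi> x0) = T / cmod (\<phi> x0)"
      using s T by (simp add: norm_mult norm_divide abs_mult)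
    also have "\<dots> = cmod c + (norm h + 1) / e" using px by (simp add: T_def)
    finally have "cmod (z s) \<ge> (norm h + 1) / e"
      using norm_triangle_ineq4[of "z s" c] by (simp add: z_def)
    moreover have pos: "(norm h + 1) / e > 0" using e by (simp add: add_nonneg_pos)
    ultimately have zs: "cmod (z s) > 0" and "norm h + 1 \<le> e * cmod (z s)"
      using e by (auto simp: field_simps)
    then have "norm h / cmod (z s) < e" by (simp add: divide_less_eq mult.commute)
    define y where "y = x0 + (1 / z s) *s h"
    have "norm ((1 / z s) *s h) < e"
      using \<open>norm h / cmod (z s) < e\<close> by (simp add: norm_vector_scalar_mult norm_divide)
    then have yK: "1 *s y \<in> K" using x0 by (auto simp: y_def dist_norm subset_iff)
    have py: "\<phi> y = \<phi> x0" by (simp add: y_def \<phi>_add \<phi>_scale ph)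
    obtain a where a: "a > 0" "\<And>t. t *s y \<in> K \<longleftrightarrow> a * (cmod t)\<^sup>2 + 2 * Re (t * \<phi> x0) \<le> 0"
      using section_through_zero[of y 1] px yK py by auto
    have zy: "z s *s y = z s *s x0 + h"
      using zs by (simp add: y_def vec_eq_iff field_simps)
    have "z s * \<phi> x0 = \<phi> v + of_real (s * T) * \<i>"
      using px by (simp add: z_def c_def field_simps)
    then have Re: "Re (z s * \<phi> x0) = Re (\<phi> v)" by simp
    \<comment> \<open>The positive zero, in \<open>r\<close>, of the section inequality at the
      parameter \<open>of_real r * z s\<close>.\<close>
    define r0 where "r0 = - 2 * Re (\<phi> v) / (a * (cmod (z s))\<^sup>2)"
    have r0: "r0 > 0" using v a zs by (simp add: r0_def divide_neg_pos)
    have "of_real r *s (z s *s x0 + h) \<in> K" if r: "0 < r" "r \<le> r0" for r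
    proof -
      have "r * (a * (cmod (z s))\<^sup>2) \<le> - 2 * Re (\<phi> v)"
        using r(2) a(1) zs pos_le_divide_eq[of "a * (cmod (z s))\<^sup>2" r "- 2 * Re (\<phi> v)"] by (simp add: r0_def)
      then have "r * (r * (a * (cmod (z s))\<^sup>2) + 2 * Re (\<phi> v)) \<le> 0"
        using r(1) by (simp add: mult_le_0_iff)
      moreover have "Re ((of_real r * z s) * \<phi> x0) = r * Re (\<phi> v)"
        using Re by (simp add: mult.assoc del: times_complex.sel) (simp add: algebra_simps)
      ultimately have "a * (cmod (of_real r * z s))\<^sup>2 + 2 * Re ((of_real r * z s) * \<phi> x0) \<le> 0"
        by (simp add: norm_mult power2_eq_square algebra_simps del: times_complex.sel)
      then have "(of_real r * z s) *s y \<in> K" using a(2) by blast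
      then show ?thesis using zy by (metis vector_smult_assoc)
    qed
    then show ?thesis using r0 by blast
  qed
  obtain r1 where r1: "r1 > 0" "\<And>r. 0 < r \<Longrightarrow> r \<le> r1 \<Longrightarrow> of_real r *s (z 1 *s x0 + h) \<in> K"
    using small[of 1] by auto
  obtain r2 where r2: "r2 > 0" "\<And>r. 0 < r \<Longrightarrow> r \<le> r2 \<Longrightarrow> of_real r *s (z (-1) *s x0 + h) \<in> K"
    using small[of "-1"] by auto
  define r where "r = min r1 r2"
  have r: "0 < r" "r \<le> r1" "r \<le> r2" using r1 r2 by (auto simp: r_def)
  have "(1/2) *\<^sub>R (of_real r *s (z 1 *s x0 + h)) + (1/2) *\<^sub>R (of_real r *s (z (-1) *s x0 + h)) \<in> K"
    using r1(2) r2(2) r convex by (intro convexD) auto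
  also have "(1/2) *\<^sub>R (of_real r *s (z 1 *s x0 + h)) + (1/2) *\<^sub>R (of_real r *s (z (-1) *s x0 + h)) = of_real r *s v"
    unfolding vec_eq_iff vector_add_component vector_scaleR_component
    by (simp add: h_def z_def scaleR_conv_of_real algebra_simps)
  finally show ?thesis using r by blast
qed

lemma section_through_zero_transversal:
  assumes v: "\<phi> v \<noteq> 0"
  shows "\<exists>a>0. \<forall>z. z *s v \<in> K \<longleftrightarrow> a * (cmod z)\<^sup>2 + 2 * Re (z * \<phi> v) \<le> 0"
proof -
  \<comment> \<open>Multiplying \<open>v\<close> by \<open>- cnj (\<phi> v)\<close> stays in the
    same complex line and makes \<phi> negative real.\<close>
  have "\<phi> ((- cnj (\<phi> v)) *s v) = - of_real ((cmod (\<phi> v))\<^sup>2)"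
    by (simp only: \<phi>_scale complex_norm_square) (simp add: mult.commute)
  then have "Re (\<phi> ((- cnj (\<phi> v)) *s v)) = - (cmod (\<phi> v))\<^sup>2" by (metis Re_complex_of_real of_real_minus)
  then have "Re (\<phi> ((- cnj (\<phi> v)) *s v)) < 0" using v by simp
  from ray_meets_body[OF this] obtain r where r: "r > 0" "(of_real r * (- cnj (\<phi> v))) *s v \<in> K"
    by (metis vector_smult_assoc)
  show ?thesis using v r(1) by (intro section_through_zero[OF v _ r(2)]) simp
qed

section \<open>Curvature of the sections through the origin\<close>

text \<open>The \<alpha> of the overview, meaningful for \<open>\<phi> v \<noteq> 0\<close>: in the
  parameter \<open>z\<close> the section is a disk of radius
  \<open>cmod (\<phi> v) / curvature v\<close>.\<close>

definition curvature :: "complex ^ 'n \<Rightarrow> real" where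
  "curvature v = (SOME a. a > 0 \<and> (\<forall>z. z *s v \<in> K \<longleftrightarrow> a * (cmod z)\<^sup>2 + 2 * Re (z * \<phi> v) \<le> 0))"

lemma curvature:
  assumes "\<phi> v \<noteq> 0"
  shows curvature_pos: "curvature v > 0"
    and smult_mem_iff: "z *s v \<in> K \<longleftrightarrow> curvature v * (cmod z)\<^sup>2 + 2 * Re (z * \<phi> v) \<le> 0"
proof -
  have "curvature v > 0 \<and> (\<forall>z. z *s v \<in> K \<longleftrightarrow> curvature v * (cmod z)\<^sup>2 + 2 * Re (z * \<phi> v) \<le> 0)"
    unfolding curvature_def by (rule someI_ex) (use section_through_zero_transversal[OF assms] in blast)
  then show "curvature v > 0" "z *s v \<in> K \<longleftrightarrow> curvature v * (cmod z)\<^sup>2 + 2 * Re (z * \<phi> v) \<le> 0" by auto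
qed

text \<open>At the parameter \<open>- t * cnj (\<phi> v)\<close> membership reads
  \<open>a * t \<le> 2\<close>, so the diameter through 0 determines \<open>a\<close>.\<close>

lemma curvature_unique:
  assumes v: "\<phi> v \<noteq> 0" and a: "a > 0"
    and eq: "\<And>z. z *s v \<in> K \<longleftrightarrow> a * (cmod z)\<^sup>2 + 2 * Re (z * \<phi> v) \<le> 0"
  shows "curvature v = a"
proof -
  have *: "a' * t \<le> 2 \<longleftrightarrow> (of_real (- t) * cnj (\<phi> v)) *s v \<in> K"
    if "t > 0" and eq: "\<And>z. z *s v \<in> K \<longleftrightarrow> a' * (cmod z)\<^sup>2 + 2 * Re (z * \<phi> v) \<le> 0" for a' t
  proof -
    have "of_real (- t) * cnj (\<phi> v) * \<phi> v = of_real (- t * (cmod (\<phi> v))\<^sup>2)"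
      by (simp only: mult.assoc of_real_mult complex_norm_square mult.commute[of "cnj (\<phi> v)"])
    then have "Re (of_real (- t) * cnj (\<phi> v) * \<phi> v) = - t * (cmod (\<phi> v))\<^sup>2"
      by (metis Re_complex_of_real)
    then have 1: "a' * (cmod (of_real (- t) * cnj (\<phi> v)))\<^sup>2 + 2 * Re (of_real (- t) * cnj (\<phi> v) * \<phi> v)
        = (t * (cmod (\<phi> v))\<^sup>2) * (a' * t - 2)"
      by (simp add: norm_mult power2_eq_square algebra_simps del: times_complex.sel)
    have "t * (cmod (\<phi> v))\<^sup>2 > 0" using that v by simp
    from mult_le_cancel_left_pos[OF this, of "a' * t - 2" 0] show ?thesis
      unfolding eq 1 by (simp only: mult_zero_right diff_le_0_iff_le)
  qed
  have eq': "a * t \<le> 2 \<longleftrightarrow> curvature v * t \<le> 2" if "t > 0" for t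
    using *[OF that eq] *[OF that smult_mem_iff[OF v]] by simp
  have "curvature v \<le> a" using eq'[of "2 / a"] a by (simp add: field_simps)
  moreover have "a \<le> curvature v" using eq'[of "2 / curvature v"] curvature_pos[OF v] by (simp add: field_simps)
  ultimately show ?thesis by simp
qed

lemma curvature_smult:
  assumes v: "\<phi> v \<noteq> 0" and c: "c \<noteq> 0"
  shows "curvature (c *s v) = (cmod c)\<^sup>2 * curvature v"
proof (rule curvature_unique)
  show "\<phi> (c *s v) \<noteq> 0" using v c by (simp add: \<phi>_scale)
  show "0 < (cmod c)\<^sup>2 * curvature v" using c curvature_pos[OF v] by simp
  fix z
  show "z *s (c *s v) \<in> K \<longleftrightarrow> (cmod c)\<^sup>2 * curvature v * (cmod z)\<^sup>2 + 2 * Re (z * \<phi> (c *s v)) \<le> 0"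
    using smult_mem_iff[OF v, of "z * c"]
    by (simp add: vector_smult_assoc \<phi>_scale norm_mult power_mult_distrib ac_simps del: times_complex.sel)
qed

text \<open>The coordinates \<open>(u, \<mu>)\<close> with \<open>\<phi> u = -1\<close> and \<open>v = u / \<mu>\<close> send the tangent hyperplane to
  infinity and turn the body into the region above the graph of the curvature.\<close>

lemma divide_mem_iff:
  assumes u: "\<phi> u = -1" and "\<mu> \<noteq> 0"
  shows "(1 / \<mu>) *s u \<in> K \<longleftrightarrow> curvature u \<le> 2 * Re \<mu>"
proof -
  have "Re (1 / \<mu>) = Re \<mu> / (cmod \<mu>)\<^sup>2" by (simp add: Re_divide' cmod_power2)
  then have "curvature u * (cmod (1 / \<mu>))\<^sup>2 + 2 * Re (1 / \<mu> * \<phi> u) = (curvature u - 2 * Re \<mu>) / (cmod \<mu>)\<^sup>2"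
    by (simp add: u norm_divide power_divide diff_divide_distrib)
  moreover have "(curvature u - 2 * Re \<mu>) / (cmod \<mu>)\<^sup>2 \<le> 0 \<longleftrightarrow> curvature u - 2 * Re \<mu> \<le> 0"
    using assms(2) by (simp add: divide_le_0_iff)
  ultimately show ?thesis using smult_mem_iff[of u "1 / \<mu>"] u by simp
qed

text \<open>The points \<open>(1 / \<mu> z) *s (u + z *s w)\<close> lie on one complex line. For
  \<open>b = 0\<close> its parameter is \<open>z\<close> itself; otherwise it is
  \<open>1 / \<mu> z\<close>, and inversion must be seen to turn the section disk into a disk in
  \<open>z\<close>.\<close>

lemma curvature_affine_sublevel:
  assumes u: "\<phi> u = -1" and w: "\<phi> w = 0" "w \<noteq> 0"
  shows "\<exists>B C. \<forall>z. curvature (u + z *s w) \<le> a + 2 * Re (b * z) \<longleftrightarrow> (cmod z)\<^sup>2 + 2 * Re (B * z) + C \<le> 0"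
proof -
  define \<mu> where "\<mu> z = of_real (a / 2) + b * z" for z
  have pu: "\<phi> (u + z *s w) = -1" for z by (simp add: \<phi>_add \<phi>_scale u w)
  have mu: "a + 2 * Re (b * z) = 2 * Re (\<mu> z)" for z by (simp add: \<mu>_def)
  have iff: "curvature (u + z *s w) \<le> a + 2 * Re (b * z) \<longleftrightarrow> \<mu> z \<noteq> 0 \<and> (1 / \<mu> z) *s (u + z *s w) \<in> K" for z
  proof (cases "\<mu> z = 0")
    case True
    then show ?thesis unfolding mu using curvature_pos[of "u + z *s w"] pu by simp
  next
    case False
    then show ?thesis unfolding mu using divide_mem_iff[OF pu False] by simp
  qed
  show ?thesis
  proof (cases "b = 0")
    case b: True
    show ?thesis
    proof (cases "a = 0")
      case True
      have "\<not> curvature (u + z *s w) \<le> 0" for z using curvature_pos[of "u + z *s w"] pu by (simp add: not_le)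
      moreover have "\<not> (cmod z)\<^sup>2 + 2 * Re (0 * z) + 1 \<le> 0" for z
        by (simp add: not_le add_nonneg_pos)
      ultimately have "\<forall>z. curvature (u + z *s w) \<le> a + 2 * Re (b * z) \<longleftrightarrow> (cmod z)\<^sup>2 + 2 * Re (0 * z) + 1 \<le> 0"
        using True b by simp
      then show ?thesis by blast
    next
      case False
      define c where "c = 1 / complex_of_real (a / 2)"
      have "c *s w \<noteq> 0" using False w by (simp add: c_def)
      from line_section[OF this, of "c *s u"] obtain B C where
        "\<And>z. c *s u + z *s (c *s w) \<in> K \<longleftrightarrow> (cmod z)\<^sup>2 + 2 * Re (B * z) + C \<le> 0" by blast
      moreover have "c *s u + z *s (c *s w) = (1 / \<mu> z) *s (u + z *s w)" for z
        by (simp add: c_def \<mu>_def b vec_eq_iff algebra_simps)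
      moreover have "\<mu> z \<noteq> 0" for z using False by (simp add: \<mu>_def b)
      ultimately show ?thesis unfolding iff by auto
    qed
  next
    case b: False
    \<comment> \<open>The point of the line \<open>u + z *s w\<close> where \<mu> vanishes.\<close>
    define d where "d = u - (of_real (a / 2) / b) *s w"
    have "\<phi> d = -1" by (simp add: d_def \<phi>_diff \<phi>_scale u w)
    then have "d \<noteq> 0" using \<phi>_zero by auto
    from line_section[OF this, of "(1 / b) *s w"] obtain B C where
      BC: "\<And>z. (1 / b) *s w + z *s d \<in> K \<longleftrightarrow> (cmod z)\<^sup>2 + 2 * Re (B * z) + C \<le> 0" by blast
    \<comment> \<open>This point corresponds to infinite \<mu>. Its absence from \<open>K\<close>
      gives \<open>C > 0\<close>, which keeps the inverted disk bounded.\<close>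
    have "(1 / b) *s w \<notin> K"
    proof
      assume "(1 / b) *s w \<in> K"
      from in_ball[OF this] have "(norm ((1 / b) *s w))\<^sup>2 \<le> 0" by (simp add: \<phi>_scale w)
      then show False using b w by simp
    qed
    then have C: "C > 0" using BC[of 0] by simp
    define N where "N = C * (cmod b)\<^sup>2"
    have N: "N > 0" using C b by (simp add: N_def)
    define B' where "B' = (cnj B * b + of_real (C * a / 2) * b) / of_real N"
    define C' where "C' = (1 + a * Re B + C * a\<^sup>2 / 4) / N"
    have "curvature (u + z *s w) \<le> a + 2 * Re (b * z) \<longleftrightarrow> (cmod z)\<^sup>2 + 2 * Re (B' * z) + C' \<le> 0" for z
    proof -
      \<comment> \<open>The section inequality at \<open>1 / \<mu> z\<close> multiplied by
        \<open>(cmod (\<mu> z))\<^sup>2\<close>. At a zero of \<mu> it equals 1, matching the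
        exclusion of such \<open>z\<close>; \<open>B'\<close> and \<open>C'\<close> come from
        expanding it in \<open>z\<close>.\<close>
      define P where "P = 1 + 2 * Re (cnj B * \<mu> z) + C * (cmod (\<mu> z))\<^sup>2"
      have "P = N * ((cmod z)\<^sup>2 + 2 * Re (B' * z) + C')"
      proof -
        have "N * Re (B' * z) = Re ((cnj B * b + of_real (C * a / 2) * b) * z)"
          using N unfolding B'_def by (simp add: divide_simps)
        moreover have "N * C' = 1 + a * Re B + C * a\<^sup>2 / 4" using N by (simp add: C'_def)
        moreover have "P = N * (cmod z)\<^sup>2 + 2 * Re ((cnj B * b + of_real (C * a / 2) * b) * z) + (1 + a * Re B + C * a\<^sup>2 / 4)"
          unfolding P_def N_def \<mu>_def cmod_power2 by (simp add: power2_eq_square field_simps)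
        ultimately show ?thesis by (simp only: distrib_left mult.left_commute[of N 2])
      qed
      moreover have "curvature (u + z *s w) \<le> a + 2 * Re (b * z) \<longleftrightarrow> P \<le> 0"
      proof (cases "\<mu> z = 0")
        case True
        then show ?thesis unfolding iff by (simp add: P_def)
      next
        case False
        have "(1 / \<mu> z) *s (u + z *s w) = (1 / b) *s w + (1 / \<mu> z) *s d"
        proof -
          have "u + z *s w = d + (\<mu> z / b) *s w"
            using b by (simp add: d_def \<mu>_def vec_eq_iff field_simps)
          then show ?thesis using False b by (simp only:) (simp add: vec_eq_iff field_simps)
        qed
        then have "curvature (u + z *s w) \<le> a + 2 * Re (b * z) \<longleftrightarrow> (cmod (1 / \<mu> z))\<^sup>2 + 2 * Re (B * (1 / \<mu> z)) + C \<le> 0"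
          unfolding iff using BC False by metis
        also have "(cmod (1 / \<mu> z))\<^sup>2 + 2 * Re (B * (1 / \<mu> z)) + C = P / (cmod (\<mu> z))\<^sup>2"
        proof -
          have "B * (1 / \<mu> z) = B * cnj (\<mu> z) / of_real ((cmod (\<mu> z))\<^sup>2)"
            using False by (simp only: complex_norm_square) (simp add: field_simps)
          then have "Re (B * (1 / \<mu> z)) = Re (B * cnj (\<mu> z)) / (cmod (\<mu> z))\<^sup>2" by (simp only: Re_divide_of_real)
          moreover have "Re (B * cnj (\<mu> z)) = Re (cnj B * \<mu> z)" by simp
          ultimately show ?thesis using False
            by (simp add: P_def norm_divide power_divide add_divide_distrib del: times_complex.sel)
        qed
        also have "\<dots> \<le> 0 \<longleftrightarrow> P \<le> 0" using False by (simp add: divide_le_0_iff)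
        finally show ?thesis .
      qed
      ultimately show ?thesis using N by (simp add: mult_le_0_iff not_less)
    qed
    then show ?thesis by blast
  qed
qed

text \<open>Rescaling \<open>u\<close> to \<open>\<phi> u1 = -1\<close> makes the paraboloid result
  available on \<open>u1 + z *s w\<close>; the homogeneity of \<open>curvature\<close> then
  reintroduces \<open>s\<close>.\<close>

lemma curvature_hermitian_on_planes:
  assumes u: "\<phi> u \<noteq> 0" and w: "\<phi> w = 0"
  shows "\<exists>A B C. (w \<noteq> 0 \<longrightarrow> A > 0) \<and> (\<forall>s t. s \<noteq> 0 \<longrightarrow>
    curvature (s *s u + t *s w) = A * (cmod t)\<^sup>2 + 2 * Re (B * t * cnj s) + C * (cmod s)\<^sup>2)"
proof (cases "w = 0")
  case True
  then show ?thesis using curvature_smult[OF u]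
    by (simp, intro exI[of _ "curvature u"] exI[of _ "0::complex"] exI[of _ "0::real"]) simp
next
  case False
  define k where "k = - \<phi> u"
  have k: "k \<noteq> 0" using u by (simp add: k_def)
  define u1 where "u1 = (1 / k) *s u"
  have u1: "\<phi> u1 = -1" using u by (simp only: u1_def k_def \<phi>_scale) simp
  from affine_sublevels_disks_imp_paraboloid[OF curvature_affine_sublevel[OF u1 w False]]
  obtain A B C where A: "A > 0"
    and F: "\<And>z. curvature (u1 + z *s w) = A * (cmod z)\<^sup>2 + 2 * Re (B * z) + C" by blast
  have "curvature (s *s u + t *s w) = A * (cmod t)\<^sup>2 + 2 * Re (B * cnj k * t * cnj s) + C * (cmod k)\<^sup>2 * (cmod s)\<^sup>2"
    if s: "s \<noteq> 0" for s t
  proof -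
    have "s *s u + t *s w = (s * k) *s (u1 + (t / (s * k)) *s w)"
      using s k by (simp add: u1_def vec_eq_iff field_simps)
    then have "curvature (s *s u + t *s w) = (cmod (s * k))\<^sup>2 * curvature (u1 + (t / (s * k)) *s w)"
      using s k u1 w by (simp only:) (intro curvature_smult, auto simp: \<phi>_add \<phi>_scale)
    also have "\<dots> = A * ((cmod (s * k))\<^sup>2 * (cmod (t / (s * k)))\<^sup>2) + 2 * ((cmod (s * k))\<^sup>2 * Re (B * (t / (s * k)))) + C * (cmod (s * k))\<^sup>2"
      unfolding F by (simp only: distrib_left ac_simps)
    also have "(cmod (s * k))\<^sup>2 * (cmod (t / (s * k)))\<^sup>2 = (cmod t)\<^sup>2"
      using s k by (simp add: norm_divide norm_mult power_divide power_mult_distrib)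
    also have "(cmod (s * k))\<^sup>2 * Re (B * (t / (s * k))) = Re (of_real ((cmod (s * k))\<^sup>2) * (B * (t / (s * k))))"
      by (rule Re_of_real_mult[symmetric])
    also have "of_real ((cmod (s * k))\<^sup>2) * (B * (t / (s * k))) = B * cnj k * t * cnj s"
      using s k by (simp only: complex_norm_square) (simp add: field_simps)
    finally show ?thesis by (simp add: norm_mult power_mult_distrib mult.assoc mult.commute[of "(cmod s)\<^sup>2"] del: times_complex.sel)
  qed
  with A show ?thesis by blast
qed

end

section \<open>Ellipsoids\<close>

definition hermitian_inner :: "complex ^ 'n \<Rightarrow> complex ^ 'n \<Rightarrow> complex" where
  "hermitian_inner x y = (\<Sum>i\<in>UNIV. x $ i * cnj (y $ i))"

lemma hermitian_inner_add: "hermitian_inner (x + y) z = hermitian_inner x z + hermitian_inner y z"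
  by (simp add: hermitian_inner_def distrib_right sum.distrib)

lemma hermitian_inner_smult: "hermitian_inner (c *s x) y = c * hermitian_inner x y"
  by (simp add: hermitian_inner_def sum_distrib_left mult.assoc)

lemma Re_hermitian_inner: "Re (hermitian_inner x y) = x \<bullet> y"
  by (simp add: hermitian_inner_def inner_vec_def inner_complex_def)

lemma norm_add_smult_square:
  fixes c d :: "complex ^ 'n"
  shows "(norm (c + z *s d))\<^sup>2 = (norm d)\<^sup>2 * (cmod z)\<^sup>2 + 2 * Re (hermitian_inner d c * z) + (norm c)\<^sup>2"
proof -
  have "(norm (c + z *s d))\<^sup>2 = (norm c)\<^sup>2 + 2 * ((z *s d) \<bullet> c) + (norm (z *s d))\<^sup>2"
    by (simp add: power2_norm_eq_inner inner_add_left inner_add_right inner_commute)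
  then show ?thesis
    by (simp only: Re_hermitian_inner[symmetric] hermitian_inner_smult norm_vector_scalar_mult
        power_mult_distrib) (simp add: mult.commute)
qed

text \<open>With \<open>q\<close> the extended form, \<open>K\<close> is given by
  \<open>q v + 2 * Re (\<phi> v) \<le> 0\<close>. In coordinates where \<open>q\<close> is the
  squared norm, completing the square exhibits a ball.\<close>

lemma (in disk_section_body) ellipsoid: "complex_ellipsoid K"
proof -
  obtain x0 e where e: "e > 0" "ball x0 e \<subseteq> K"
    using interior by (meson ex_in_conv mem_interior)
  have "\<exists>u0. \<phi> u0 \<noteq> 0"
  proof (rule ccontr)
    assume "\<not> ?thesis"
    then have "K \<subseteq> {0}" using in_ball by fastforce
    with e have "ball x0 e \<subseteq> {0}" by blast
    moreover have "infinite (ball x0 e)" using e(1) uncountable_ball countable_finite by blast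
    ultimately show False using finite_subset by blast
  qed
  then obtain u0 where u0: "\<phi> u0 \<noteq> 0" by blast
  obtain q where q: "\<And>v. \<phi> v \<noteq> 0 \<Longrightarrow> q v = curvature v"
    "\<And>x y. q (x + y) + q (x - y) = 2 * q x + 2 * q y" "\<And>c x. q (c *s x) = (cmod c)\<^sup>2 * q x"
    "\<And>t x y. q (complex_of_real t *s x + y) - q (complex_of_real t *s x) - q y = t * (q (x + y) - q x - q y)"
    and q_pos: "\<And>x. x \<noteq> 0 \<Longrightarrow> q x > 0"
    using hermitian_form_extends_from_hyperplane_complement[OF \<phi>_add \<phi>_scale u0
        curvature_hermitian_on_planes curvature_pos] by blast
  obtain E :: "complex ^ 'n ^ 'n" where E: "invertible E" "\<And>z. q (E *v z) = (norm z)\<^sup>2"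
    using positive_hermitian_form_diagonalizable[OF q(2-4) q_pos] by blast
  have mem_K: "v \<in> K \<longleftrightarrow> q v + 2 * Re (\<phi> v) \<le> 0" for v
  proof (cases "\<phi> v = 0")
    case True
    then have "v \<in> K \<longleftrightarrow> v = 0" using in_ball[of v] zero_mem by auto
    also have "\<dots> \<longleftrightarrow> q v + 2 * Re (\<phi> v) \<le> 0"
      using True q_pos[of v] q(3)[of 0 0] by (cases "v = 0") auto
    finally show ?thesis .
  next
    case False
    then show ?thesis using smult_mem_iff[OF False, of 1] q(1) by simp
  qed
  \<comment> \<open>Represents the functional \<phi> in the coordinates given by \<open>E\<close>;
    the ball there has centre \<open>- d\<close> and radius \<open>norm d\<close>.\<close>
  define d :: "complex ^ 'n" where "d = (\<chi> i. cnj (\<phi> (column i E)))"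
  have \<phi>_sum: "\<phi> (\<Sum>i\<in>S. f i) = (\<Sum>i\<in>S. \<phi> (f i))" for S :: "'n set" and f
    by (induction S rule: infinite_finite_induct) (simp_all add: \<phi>_add \<phi>_zero)
  have \<phi>E: "\<phi> (E *v z) = hermitian_inner z d" for z
    by (simp add: matrix_mult_sum \<phi>_sum \<phi>_scale hermitian_inner_def d_def)
  have E_mem: "E *v z \<in> K \<longleftrightarrow> norm (z + d) \<le> norm d" for z
  proof -
    have "(norm (z + d))\<^sup>2 = (norm z)\<^sup>2 + 2 * (z \<bullet> d) + (norm d)\<^sup>2"
      by (simp add: power2_norm_eq_inner inner_add_left inner_add_right inner_commute)
    then have "E *v z \<in> K \<longleftrightarrow> (norm (z + d))\<^sup>2 \<le> (norm d)\<^sup>2"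
      by (simp add: mem_K E \<phi>E Re_hermitian_inner)
    then show ?thesis by (simp add: abs_le_square_iff[symmetric])
  qed
  obtain E' where E': "E ** E' = mat 1" "E' ** E = mat 1" using E(1) by (auto simp: invertible_def)
  have EE': "E *v (E' *v v) = v" and E'E: "E' *v (E *v v) = v" for v
    by (simp_all add: matrix_vector_mul_assoc E')
  have d: "norm d > 0"
  proof -
    have "hermitian_inner (E' *v u0) d \<noteq> 0" using u0 \<phi>E[of "E' *v u0"] EE' by simp
    then have "d \<noteq> 0" by (auto simp: hermitian_inner_def)
    then show ?thesis by simp
  qed
  define A :: "complex ^ 'n ^ 'n" where "A = (\<chi> i j. of_real (norm d) * E $ i $ j)"
  have A: "A *v z = E *v (of_real (norm d) *s z)" for z
    by (simp add: A_def vec_eq_iff matrix_vector_mult_def mult.assoc mult.left_commute)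
  have "inj ((*v) A)"
  proof (rule injI)
    fix x y assume "A *v x = A *v y"
    then have "of_real (norm d) *s x = of_real (norm d) *s y" unfolding A by (metis E'E)
    then show "x = y" using d by (simp only: vec.scale_cancel_left) auto
  qed
  then have "invertible A"
    using matrix_left_invertible_injective invertible_left_inverse by blast
  moreover have "K = (\<lambda>z. A *v z + E *v (- d)) ` cball 0 1"
  proof (intro equalityI subsetI)
    fix v assume "v \<in> K"
    define z where "z = of_real (1 / norm d) *s (E' *v v + d)"
    have "norm (E' *v v + d) \<le> norm d" using E_mem[of "E' *v v"] EE' \<open>v \<in> K\<close> by simp
    moreover have "norm z = \<bar>1 / norm d\<bar> * norm (E' *v v + d)"
      by (simp only: z_def norm_vector_scalar_mult norm_of_real)
    ultimately have "z \<in> cball 0 1" using d by simp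
    moreover have "of_real (norm d) *s z = E' *v v + d"
      using d by (simp add: z_def vector_smult_assoc flip: of_real_mult)
    then have "A *v z + E *v (- d) = v"
      unfolding A by (simp add: matrix_vector_right_distrib[symmetric] EE')
    ultimately show "v \<in> (\<lambda>z. A *v z + E *v (- d)) ` cball 0 1" by force
  next
    fix v assume "v \<in> (\<lambda>z. A *v z + E *v (- d)) ` cball 0 1"
    then obtain z where z: "norm z \<le> 1" and v: "v = E *v (of_real (norm d) *s z + - d)"
      by (auto simp: A matrix_vector_right_distrib simp del: add_uminus_conv_diff)
    have "norm (of_real (norm d) *s z) = norm d * norm z"
      by (simp only: norm_vector_scalar_mult norm_of_real abs_norm_cancel)
    also have "\<dots> \<le> norm d" using z d by (simp add: mult_left_le)
    finally show "v \<in> K" unfolding v E_mem by simp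
  qed
  ultimately show ?thesis unfolding complex_ellipsoid_def by blast
qed

section \<open>Complex line sections as quadratic inequalities\<close>

text \<open>The parametrization by \<open>z\<close> multiplies distances by \<open>norm v\<close>.
  In centred form \<open>(cmod (z - c))\<^sup>2 \<le> D\<close>, the sign of \<open>D\<close>
  separates the three geometric cases.\<close>

lemma line_section_disk_iff:
  fixes x v :: "complex ^ 'n"
  assumes v: "v \<noteq> 0"
  defines "L \<equiv> complex_line x v"
  shows "(L \<inter> K = {} \<or> (\<exists>p. L \<inter> K = {p}) \<or> is_disk_in (L \<inter> K) L) \<longleftrightarrow>
    (\<exists>B C. \<forall>z. x + z *s v \<in> K \<longleftrightarrow> (cmod z)\<^sup>2 + 2 * Re (B * z) + C \<le> 0)"
proof -
  have inj: "x + z *s v = x + z' *s v \<longleftrightarrow> z = z'" for z z'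
    using v by (auto simp: vec_eq_iff)
  have L: "L \<inter> S = (\<lambda>z. x + z *s v) ` {z. x + z *s v \<in> S}" for S
    by (auto simp: L_def complex_line_def)
  have mem: "x + z *s v \<in> K \<longleftrightarrow> x + z *s v \<in> L \<inter> K" for z
    by (auto simp: L_def complex_line_def)
  have LE: "\<exists>z. y = x + z *s v" if "y \<in> L" for y
    using that by (auto simp: L_def complex_line_def)
  have cball: "x + z *s v \<in> cball (x + c *s v) r \<longleftrightarrow> cmod (z - c) \<le> r / norm v" for z c r
  proof -
    have "dist (x + c *s v) (x + z *s v) = norm ((z - c) *s v)"
      by (simp add: dist_norm norm_minus_commute vector_sub_rdistrib)
    then have "x + z *s v \<in> cball (x + c *s v) r \<longleftrightarrow> cmod (z - c) * norm v \<le> r"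
      by (simp only: mem_cball norm_vector_scalar_mult)
    then show ?thesis using v pos_le_divide_eq[of "norm v" "cmod (z - c)" r] by (simp only: zero_less_norm_iff) simp
  qed
  have "(\<exists>B C. \<forall>z. x + z *s v \<in> K \<longleftrightarrow> (cmod z)\<^sup>2 + 2 * Re (B * z) + C \<le> 0) \<longleftrightarrow>
      (\<exists>c D. \<forall>z. x + z *s v \<in> K \<longleftrightarrow> (cmod (z - c))\<^sup>2 \<le> D)" (is "_ \<longleftrightarrow> ?R")
  proof
    assume "\<exists>B C. \<forall>z. x + z *s v \<in> K \<longleftrightarrow> (cmod z)\<^sup>2 + 2 * Re (B * z) + C \<le> 0"
    then obtain B C where "\<forall>z. x + z *s v \<in> K \<longleftrightarrow> (cmod (z - (- cnj B)))\<^sup>2 \<le> (cmod B)\<^sup>2 - C"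
      unfolding disk_inequality_iff by auto
    then show ?R by blast
  next
    assume ?R
    then obtain c D where "\<forall>z. x + z *s v \<in> K \<longleftrightarrow> (cmod (z - c))\<^sup>2 \<le> D" by blast
    then show "\<exists>B C. \<forall>z. x + z *s v \<in> K \<longleftrightarrow> (cmod z)\<^sup>2 + 2 * Re (B * z) + C \<le> 0"
      unfolding disk_inequality_iff
      by (intro exI[of _ "- cnj c"] exI[of _ "(cmod c)\<^sup>2 - D"]) simp
  qed
  also have "\<dots> \<longleftrightarrow> L \<inter> K = {} \<or> (\<exists>p. L \<inter> K = {p}) \<or> is_disk_in (L \<inter> K) L"
  proof
    assume ?R
    then obtain c D where cD: "\<And>z. x + z *s v \<in> K \<longleftrightarrow> (cmod (z - c))\<^sup>2 \<le> D" by blast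
    consider "D < 0" | "D = 0" | "D > 0" by linarith
    then show "L \<inter> K = {} \<or> (\<exists>p. L \<inter> K = {p}) \<or> is_disk_in (L \<inter> K) L"
    proof cases
      case 1
      have "x + z *s v \<notin> K" for z
        using cD[of z] 1 zero_le_power2[of "cmod (z - c)"] by linarith
      then show ?thesis by (simp add: L)
    next
      case 2
      have "x + z *s v \<in> K \<longleftrightarrow> z = c" for z using cD[of z] 2 by simp
      then have "L \<inter> K = {x + c *s v}" by (simp add: L)
      then show ?thesis by blast
    next
      case 3
      have "x + z *s v \<in> K \<longleftrightarrow> x + z *s v \<in> cball (x + c *s v) (sqrt D * norm v)" for z
        unfolding cD cball using 3 v real_sqrt_le_iff[of "(cmod (z - c))\<^sup>2" D] by simp
      then have "L \<inter> K = L \<inter> cball (x + c *s v) (sqrt D * norm v)" by (simp only: L)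
      moreover have "x + c *s v \<in> L" "sqrt D * norm v > 0"
        using 3 v by (auto simp: L_def complex_line_def)
      ultimately show ?thesis unfolding is_disk_in_def by blast
    qed
  next
    assume "L \<inter> K = {} \<or> (\<exists>p. L \<inter> K = {p}) \<or> is_disk_in (L \<inter> K) L"
    then consider "L \<inter> K = {}" | p where "L \<inter> K = {p}"
      | p r where "p \<in> L" "r > 0" "L \<inter> K = L \<inter> cball p r"
      unfolding is_disk_in_def by blast
    then show ?R
    proof cases
      case 1
      then have "x + z *s v \<notin> K" for z using mem by simp
      moreover have "\<not> (cmod (z - 0))\<^sup>2 \<le> - 1" for z
        using zero_le_power2[of "cmod (z - 0)"] by linarith
      ultimately show ?thesis by blast
    next
      case 2
      then obtain c where "p = x + c *s v" using LE by blast
      then have "x + z *s v \<in> K \<longleftrightarrow> z = c" for z unfolding mem 2 using inj by simp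
      then have "\<forall>z. x + z *s v \<in> K \<longleftrightarrow> (cmod (z - c))\<^sup>2 \<le> 0" by simp
      then show ?thesis by blast
    next
      case 3
      then obtain c where c: "p = x + c *s v" using LE by blast
      have "x + z *s v \<in> K \<longleftrightarrow> x + z *s v \<in> cball (x + c *s v) r" for z
        unfolding mem 3(3) c by (auto simp: L_def complex_line_def)
      then have "\<forall>z. x + z *s v \<in> K \<longleftrightarrow> (cmod (z - c))\<^sup>2 \<le> (r / norm v)\<^sup>2"
        unfolding cball using 3 by (simp add: abs_le_square_iff[symmetric])
      then show ?thesis by blast
    qed
  qed
  finally show ?thesis by blast
qed

text \<open>Pulling back to the unit ball gives a squared-norm condition quadratic in
  \<open>z\<close>; dividing by the leading coefficient normalizes it.\<close>

lemma ellipsoid_line_section: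
  fixes v :: "complex ^ 'n"
  assumes "complex_ellipsoid K" and v: "v \<noteq> 0"
  shows "\<exists>B C. \<forall>z. x + z *s v \<in> K \<longleftrightarrow> (cmod z)\<^sup>2 + 2 * Re (B * z) + C \<le> 0"
proof -
  obtain A :: "complex ^ 'n ^ 'n" and b where A: "invertible A" and K: "K = (\<lambda>z. A *v z + b) ` cball 0 1"
    using assms(1) unfolding complex_ellipsoid_def by blast
  obtain A' where A': "A ** A' = mat 1" "A' ** A = mat 1" using A by (auto simp: invertible_def)
  have AA': "A *v (A' *v y) = y" and A'A: "A' *v (A *v y) = y" for y
    by (simp_all add: matrix_vector_mul_assoc A')
  have mem: "y \<in> K \<longleftrightarrow> norm (A' *v (y - b)) \<le> 1" for y
  proof
    assume "norm (A' *v (y - b)) \<le> 1"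
    moreover have "y = A *v (A' *v (y - b)) + b" by (simp add: AA')
    ultimately show "y \<in> K" unfolding K by force
  qed (auto simp: K A'A)
  define c where "c = A' *v (x - b)"
  define d where "d = A' *v v"
  have d: "norm d > 0" using v AA'[of v] by (auto simp: d_def)
  have "x + z *s v \<in> K \<longleftrightarrow>
      (cmod z)\<^sup>2 + 2 * Re (hermitian_inner d c / of_real ((norm d)\<^sup>2) * z) + ((norm c)\<^sup>2 - 1) / (norm d)\<^sup>2 \<le> 0" for z
  proof -
    have "A' *v (x + z *s v - b) = c + z *s d"
    proof -
      have "x + z *s v - b = (x - b) + z *s v" by simp
      then show ?thesis
        by (simp only: c_def d_def matrix_vector_right_distrib vector_scalar_commute)
    qed
    then have "x + z *s v \<in> K \<longleftrightarrow> (norm (c + z *s d))\<^sup>2 \<le> 1"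
      unfolding mem by (simp add: abs_square_le_1)
    also have "\<dots> \<longleftrightarrow> ((norm (c + z *s d))\<^sup>2 - 1) / (norm d)\<^sup>2 \<le> 0"
      using d by (simp add: divide_le_0_iff)
    also have "((norm (c + z *s d))\<^sup>2 - 1) / (norm d)\<^sup>2 =
      (cmod z)\<^sup>2 + 2 * (Re (hermitian_inner d c * z) / (norm d)\<^sup>2) + ((norm c)\<^sup>2 - 1) / (norm d)\<^sup>2"
      unfolding norm_add_smult_square using d
      by (simp add: add_divide_distrib diff_divide_distrib del: times_complex.sel)
    also have "Re (hermitian_inner d c * z) / (norm d)\<^sup>2 = Re (hermitian_inner d c / of_real ((norm d)\<^sup>2) * z)"
      by (simp only: Re_divide_of_real[symmetric] times_divide_eq_left)
    finally show ?thesis .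
  qed
  then show ?thesis by blast
qed

theorem theorem3p1:
  fixes K :: "(complex ^ 'n) set"
  assumes "convex_body K"
  shows "complex_ellipsoid K \<longleftrightarrow>
           (\<forall>L. is_complex_line L \<longrightarrow>
              (L \<inter> K = {} \<or> (\<exists>p. L \<inter> K = {p}) \<or> is_disk_in (L \<inter> K) L))"
proof
  assume ell: "complex_ellipsoid K"
  show "\<forall>L. is_complex_line L \<longrightarrow> (L \<inter> K = {} \<or> (\<exists>p. L \<inter> K = {p}) \<or> is_disk_in (L \<inter> K) L)"
  proof (intro allI impI)
    fix L :: "(complex ^ 'n) set" assume "is_complex_line L"
    then obtain x v where v: "v \<noteq> 0" and L: "L = complex_line x v" by (auto simp: is_complex_line_def)
    show "L \<inter> K = {} \<or> (\<exists>p. L \<inter> K = {p}) \<or> is_disk_in (L \<inter> K) L"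
      unfolding L line_section_disk_iff[OF v] by (rule ellipsoid_line_section[OF ell v])
  qed
next
  assume disks: "\<forall>L. is_complex_line L \<longrightarrow> (L \<inter> K = {} \<or> (\<exists>p. L \<inter> K = {p}) \<or> is_disk_in (L \<inter> K) L)"
  have sec: "\<exists>B C. \<forall>z. x + z *s v \<in> K \<longleftrightarrow> (cmod z)\<^sup>2 + 2 * Re (B * z) + C \<le> 0" if v: "v \<noteq> 0" for x v
  proof -
    have "is_complex_line (complex_line x v)" using v by (auto simp: is_complex_line_def)
    from disks[rule_format, OF this] show ?thesis unfolding line_section_disk_iff[OF v] .
  qed
  have K: "compact K" "convex K" "interior K \<noteq> {}" using assms by (auto simp: convex_body_def)
  then have "K \<noteq> {}" by auto
  \<comment> \<open>Since \<open>K\<close> lies in the ball of radius \<open>norm p\<close> about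
    the origin, translating \<open>p\<close> to 0 yields \<open>in_ball\<close> with the functional
    \<open>hermitian_inner v p\<close>.\<close>
  then obtain p where p: "p \<in> K" "\<And>x. x \<in> K \<Longrightarrow> norm x \<le> norm p"
    using continuous_attains_sup[OF K(1), of norm] continuous_on_norm_id by blast
  define K' where "K' = (\<lambda>v. - p + v) ` K"
  have mem: "v \<in> K' \<longleftrightarrow> p + v \<in> K" for v
    by (force simp: K'_def)
  interpret disk_section_body K' "\<lambda>v. hermitian_inner v p"
  proof
    show "convex K'" unfolding K'_def using K(2) by (rule convex_translation)
    show "interior K' \<noteq> {}" unfolding K'_def interior_translation using K(3) by simp
    show "0 \<in> K'" using p by (simp add: mem)
    fix v :: "complex ^ 'n"
    assume "v \<in> K'"
    then have "norm (p + v) \<le> norm p" using p mem by blast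
    then have "(norm (p + v))\<^sup>2 \<le> (norm p)\<^sup>2" by (intro power_mono) auto
    moreover have "(norm (p + v))\<^sup>2 = (norm p)\<^sup>2 + 2 * (v \<bullet> p) + (norm v)\<^sup>2"
      by (simp add: power2_norm_eq_inner inner_add_left inner_add_right inner_commute)
    ultimately show "(norm v)\<^sup>2 + 2 * Re (hermitian_inner v p) \<le> 0"
      by (simp add: Re_hermitian_inner)
  next
    fix x v :: "complex ^ 'n"
    assume "v \<noteq> 0"
    from sec[OF this, of "p + x"]
    show "\<exists>B C. \<forall>z. x + z *s v \<in> K' \<longleftrightarrow> (cmod z)\<^sup>2 + 2 * Re (B * z) + C \<le> 0"
      by (simp add: mem add.assoc)
  qed (simp_all add: hermitian_inner_add hermitian_inner_smult)
  obtain A :: "complex ^ 'n ^ 'n" and b where A: "invertible A" "K' = (\<lambda>z. A *v z + b) ` cball 0 1"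
    using ellipsoid unfolding complex_ellipsoid_def by blast
  have "K = (+) p ` K'" by (simp add: K'_def image_image)
  also have "\<dots> = (\<lambda>z. A *v z + (p + b)) ` cball 0 1"
    unfolding A(2) image_image by (simp add: add.left_commute)
  finally show "complex_ellipsoid K" unfolding complex_ellipsoid_def using A(1) by blast
qed

end
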